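(* Let $\mu$ be a probability measure on $[0,\infty)$ with $\int_0^\infty r^2\,\mu(\mathrm{d}r)<\infty$, and consider Poisson Boolean percolation in $\mathbb{R}^2$ with radius distribution $\mu$. If $\lambda>0$ is such that $$\lim_{\ell\to\infty}\mathbb{P}_\lambda[\mathrm{Cross}(\ell,3\ell)]=0,$$ then, $\mathbb{P}_\lambda$-almost surely, the vacant set $\mathcal{V}$ has an unbounded connected component.
   Context: Poisson Boolean percolation in $\mathbb{R}^2$ with intensity $\lambda\ge 0$ and radius distribution $\mu$: under the probability measure $\mathbb{P}_\lambda$, $\omega$ is a Poisson point process on $\mathbb{R}^2\times[0,\infty)$ with intensity measure $\lambda\,\mathrm{d}x\otimes\mu(\mathrm{d}z)$. Let $B(x,z)$ be the open Euclidean ball with centre $x$ and radius $z$. The occupied set is $\mathcal{O}=\bigcup_{(x,z)\in\omega}B(x,z)$ and the vacant set is $\mathcal{V}=\mathbb{R}^2\setminus\mathcal{O}$. For $\ell,r>0$, $\mathrm{Cross}(\ell,r)$ is the event that the box $[0,\ell]\times[0,r]$ can be crossed from left to right by an occupied path, i.e. there is a continuous path contained in $\mathcal{O}\cap([0,\ell]\times[0,r])$ from $\{0\}\times[0,r]$ to $\{\ell\}\times[0,r]$. *)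

theory Defs
  imports "HOL-Probability.Probability"
begin

text \<open>
  Point configurations are represented by sets, so that only simple point processes are covered.
  This is no restriction when the intensity has no atoms, as is the case below: a Poisson process
  is then almost surely simple. Local finiteness (up to a null set, on sets of finite intensity)
  is part of the Poisson law of the counts.
\<close>

definition point_count :: "'e set \<Rightarrow> 'e set \<Rightarrow> ennreal" where
  "point_count \<eta> A = emeasure (count_space UNIV) (\<eta> \<inter> A)"

definition poisson_point_process :: "'w measure \<Rightarrow> 'e measure \<Rightarrow> ('w \<Rightarrow> 'e set) \<Rightarrow> bool" where
  "poisson_point_process M \<nu> \<omega> \<longleftrightarrow>
     prob_space M \<and>
     (\<forall>w\<in>space M. \<omega> w \<subseteq> space \<nu>) \<and>
     (\<forall>A\<in>sets \<nu>. (\<lambda>w. point_count (\<omega> w) A) \<in> borel_measurable M) \<and>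
     (\<forall>A\<in>sets \<nu>. emeasure \<nu> A < \<infinity> \<longrightarrow>
        (\<forall>k::nat. measure M {w\<in>space M. point_count (\<omega> w) A = of_nat k} =
           exp (- measure \<nu> A) * measure \<nu> A ^ k / fact k)) \<and>
     (\<forall>A\<in>sets \<nu>. emeasure \<nu> A = \<infinity> \<longrightarrow> (AE w in M. point_count (\<omega> w) A = \<infinity>)) \<and>
     (\<forall>(A :: nat \<Rightarrow> 'e set) I. finite I \<and> A ` I \<subseteq> sets \<nu> \<and> disjoint_family_on A I \<longrightarrow>
        prob_space.indep_vars M (\<lambda>_. borel) (\<lambda>i w. point_count (\<omega> w) (A i)) I)"

text \<open>
  The plane is \<open>real \<times> real\<close>, whose library metric is the Euclidean one. A radius distribution on
  \<open>[0, \<infinity>)\<close> is a measure whose underlying space is the half-line itself.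
\<close>

definition radius_distribution :: "real measure \<Rightarrow> bool" where
  "radius_distribution \<mu> \<longleftrightarrow> prob_space \<mu> \<and> sets \<mu> = sets (restrict_space borel {0..})"

definition boolean_intensity :: "real \<Rightarrow> real measure \<Rightarrow> ((real \<times> real) \<times> real) measure" where
  "boolean_intensity lam \<mu> = scale_measure (ennreal lam) (lborel \<Otimes>\<^sub>M \<mu>)"

definition occupied :: "((real \<times> real) \<times> real) set \<Rightarrow> (real \<times> real) set" where
  "occupied \<eta> = (\<Union>(x, z)\<in>\<eta>. ball x z)"

definition vacant :: "((real \<times> real) \<times> real) set \<Rightarrow> (real \<times> real) set" where
  "vacant \<eta> = - occupied \<eta>"

definition crossed :: "((real \<times> real) \<times> real) set \<Rightarrow> real \<Rightarrow> real \<Rightarrow> bool" where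
  "crossed \<eta> l r \<longleftrightarrow>
     (\<exists>g. path g \<and> path_image g \<subseteq> occupied \<eta> \<inter> ({0..l} \<times> {0..r}) \<and>
          pathstart g \<in> {0} \<times> {0..r} \<and> pathfinish g \<in> {l} \<times> {0..r})"

text \<open>
  \<open>cross_event\<close> is measurable whenever \<open>\<omega>\<close> is a Poisson process: a crossing path is compact, hence
  uses finitely many balls, and the tuples of balls whose union contains a crossing form an open
  set, so that the event is a countable combination of events \<open>point_count (\<omega> w) A > 0\<close>. In
  particular \<open>measure M (cross_event M \<omega> l r)\<close> is its actual probability.
\<close>

definition cross_event ::
    "'w measure \<Rightarrow> ('w \<Rightarrow> ((real \<times> real) \<times> real) set) \<Rightarrow> real \<Rightarrow> real \<Rightarrow> 'w set" where
  "cross_event M \<omega> l r = {w\<in>space M. crossed (\<omega> w) l r}"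

end

theory Submission
  imports Defs
begin

text \<open>
  Call \<^emph>\<open>arm\<close> at a point \<open>y\<close> and scale \<open>l\<close> an occupied path from the closed ball of radius \<open>l\<close> around
  \<open>y\<close> to distance \<open>6 * l\<close> from \<open>y\<close>. An arm crosses, the short way, one of the four rectangles of
  shape \<open>2 * l\<close> by \<open>6 * l\<close> placed around the square of half side \<open>l\<close>, so its probability is at most four
  times the crossing probability of the hypothesis and tends to \<open>0\<close>
  (\<open>prob_arm_le_crossed\<close>). If all components of the vacant set were bounded, the origin would be
  surrounded by occupied sets at arbitrarily large distances, and so at infinitely many of the
  scales \<open>5 ^ n\<close> there would be an arm based in a bounded number of positions at distance of order
  \<open>5 ^ n\<close> from the origin (\<open>unbounded_vacant_component_if_no_arms\<close>). It remains to make the arm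
  probabilities summable over the scales and to apply the Borel--Cantelli lemma.

  A second moment does not bound the sum over \<open>n\<close> of the probability that a ball of radius above
  \<open>5 ^ n\<close> comes within distance \<open>5 ^ n\<close> of the origin: one huge ball contributes to many scales. The sum of
  the expected numbers \<open>a n\<close> of such balls with radius between \<open>5 ^ n\<close> and \<open>5 ^ Suc n\<close> is finite,
  however, because each ball now counts once (\<open>summable_radius_mass\<close>). This has two uses.

  \<^item> Almost surely, only finitely many balls have a radius that is not small compared with their
    distance from the origin (\<open>AE_eventually_no_large_balls\<close>). So it is enough to control the largest
    probability \<open>u n\<close> over \<open>y\<close> of an arm at \<open>y\<close> and scale \<open>5 ^ n\<close> that is made of balls of radius at
    most \<open>5 ^ n\<close>.

  \<^item> An arm at scale \<open>5 ^ Suc n\<close> contains arms at scale \<open>5 ^ n\<close> near both of its ends. With the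
    radii truncated at \<open>5 ^ Suc n\<close> these depend on disjoint parts of the process, and the truncation can be
    lowered to \<open>5 ^ n\<close> at the cost of an error of order \<open>a n\<close>. Therefore
    \<open>u (Suc n) \<le> K * (u n + c * a n)\<^sup>2\<close> (\<open>max_arm_prob_Suc_le\<close>). Since \<open>u\<close> tends to \<open>0\<close>, the
    square gains a factor \<open>1 / 2\<close> in the long run, and \<open>u\<close> inherits summability from \<open>a\<close>
    (\<open>summable_of_quadratic_recursion\<close>).

  All probabilistic input is contained in the avoidance probabilities of the Poisson process, that
  is, the probabilities that a set receives no point. The avoidance events are closed under
  intersection, so these numbers determine the law of the process; this yields its isometry
  invariance and its independence over disjoint regions.
\<close>

section \<open>Plane topology\<close>

text \<open>
  Cut the path at the first time at which \<open>\<phi>\<close> reaches \<open>b\<close>, and then at the last time before it at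
  which \<open>\<phi>\<close> is at most \<open>a\<close>. The instances used below take for \<open>\<phi>\<close> a distance, a supremum norm or a coordinate.
\<close>

lemma subpath_between_levels:
  fixes g :: "real \<Rightarrow> 'a::real_normed_vector" and \<phi> :: "'a \<Rightarrow> real"
  assumes "path g" and \<phi>: "continuous_on UNIV \<phi>"
    and lo: "\<phi> (pathstart g) \<le> a" and hi: "b \<le> \<phi> (pathfinish g)" and "a \<le> b"
  obtains h where "path h" "path_image h \<subseteq> path_image g"
    "\<phi> (pathstart h) = a" "\<phi> (pathfinish h) = b"
    "\<forall>p\<in>path_image h. a \<le> \<phi> p \<and> \<phi> p \<le> b"
proof -
  define \<psi> where "\<psi> = (\<lambda>t. \<phi> (g t))"
  have cont: "continuous_on {0..1} \<psi>"
    unfolding \<psi>_def using \<open>path g\<close> \<phi> by (auto simp: path_def intro: continuous_on_compose2)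
  have cont_sub: "continuous_on {s..t} \<psi>" if "0 \<le> s" "t \<le> 1" for s t
    using cont by (rule continuous_on_subset) (use that in auto)
  define U where "U = {0..1} \<inter> \<psi> -` {b..}"
  have "closed U" "U \<subseteq> {0..1}" "1 \<in> U"
    using continuous_closed_preimage[OF cont] hi
    by (auto simp: U_def \<psi>_def pathfinish_def)
  then obtain t where t: "t \<in> U" "\<And>s. s \<in> U \<Longrightarrow> t \<le> s"
    using compact_attains_inf[of U] by (metis bounded_closed_interval bounded_subset compact_eq_bounded_closed empty_iff)
  have t01: "0 \<le> t" "t \<le> 1" and "b \<le> \<psi> t" using t(1) by (auto simp: U_def)
  have before: "\<psi> s < b" if "0 \<le> s" "s < t" for s
    using t(2)[of s] that t01 by (force simp: U_def)
  have "\<psi> t = b"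
  proof (rule ccontr)
    assume "\<psi> t \<noteq> b"
    then have "b < \<psi> t" using \<open>b \<le> \<psi> t\<close> by simp
    moreover have "\<psi> 0 \<le> b" using lo \<open>a \<le> b\<close> by (simp add: \<psi>_def pathstart_def)
    ultimately obtain s where "0 \<le> s" "s \<le> t" "\<psi> s = b"
      using IVT'[of \<psi> 0 b t] cont_sub[of 0 t] t01 by auto
    with before[of s] \<open>b < \<psi> t\<close> show False by (cases "s = t") auto
  qed
  define L where "L = {0..t} \<inter> \<psi> -` {..a}"
  have "closed L" "L \<subseteq> {0..t}" "0 \<in> L"
    using continuous_closed_preimage[OF cont_sub[of 0 t]] lo t01
    by (auto simp: L_def \<psi>_def pathstart_def)
  then obtain s where s: "s \<in> L" "\<And>r. r \<in> L \<Longrightarrow> r \<le> s"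
    using compact_attains_sup[of L] by (metis bounded_closed_interval bounded_subset compact_eq_bounded_closed empty_iff)
  have s0: "0 \<le> s" "s \<le> t" and "\<psi> s \<le> a" using s(1) by (auto simp: L_def)
  have after: "a < \<psi> r" if "s < r" "r \<le> t" for r
    using s(2)[of r] that s0 by (force simp: L_def)
  have "\<psi> s = a"
  proof (rule ccontr)
    assume "\<psi> s \<noteq> a"
    then have "\<psi> s < a" using \<open>\<psi> s \<le> a\<close> by simp
    moreover have "a \<le> \<psi> t" using \<open>\<psi> t = b\<close> \<open>a \<le> b\<close> by simp
    ultimately obtain r where "s \<le> r" "r \<le> t" "\<psi> r = a"
      using IVT'[of \<psi> s a t] cont_sub[of s t] t01 s0 by auto
    with after[of r] \<open>\<psi> s < a\<close> show False by (cases "s = r") auto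
  qed
  have img: "path_image (subpath s t g) = g ` {s..t}"
    using s0 by (simp add: path_image_subpath)
  show thesis
  proof
    show "path (subpath s t g)" using \<open>path g\<close> s0 t01 by simp
    show "path_image (subpath s t g) \<subseteq> path_image g"
      unfolding img using s0 t01 by (auto simp: path_image_def)
    show "\<phi> (pathstart (subpath s t g)) = a" "\<phi> (pathfinish (subpath s t g)) = b"
      using \<open>\<psi> s = a\<close> \<open>\<psi> t = b\<close> by (simp_all add: \<psi>_def)
    show "\<forall>p\<in>path_image (subpath s t g). a \<le> \<phi> p \<and> \<phi> p \<le> b"
    proof
      fix p assume "p \<in> path_image (subpath s t g)"
      obtain r where "r \<in> {s..t}" "p = g r" using \<open>p \<in> _\<close> unfolding img by (rule imageE)
      then have r: "p = g r" "s \<le> r" "r \<le> t" by auto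
      have "\<psi> r \<le> b" using before[of r] r s0 \<open>\<psi> t = b\<close> by (cases "r = t") auto
      moreover have "a \<le> \<psi> r" using after[of r] r \<open>\<psi> s = a\<close> by (cases "r = s") auto
      ultimately show "a \<le> \<phi> p \<and> \<phi> p \<le> b" using r by (simp add: \<psi>_def)
    qed
  qed
qed

text \<open>
  A compact component of a locally compact space has arbitrarily small compact open neighbourhoods
  (Sura-Bura). Finitely many of them cover the compact set \<open>V \<inter> B\<close>.
\<close>

lemma bounded_components_imp_compact_clopen:
  fixes V :: "'a::euclidean_space set"
  assumes "closed V" and bdd: "\<And>C. C \<in> components V \<Longrightarrow> bounded C" and "compact B"
  obtains U where "compact U" "closed (V - U)" "V \<inter> B \<subseteq> U" "U \<subseteq> V"
proof -
  have "\<exists>K. openin (top_of_set V) K \<and> compact K \<and> x \<in> K" if "x \<in> V" for x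
  proof -
    let ?C = "connected_component_set V x"
    have C: "?C \<in> components V" using that by (simp add: componentsI)
    have "compact ?C"
      using bdd[OF C] closed_components[OF \<open>closed V\<close> C] by (simp add: compact_eq_bounded_closed)
    with Sura_Bura_clopen_subset[OF closed_imp_locally_compact[OF \<open>closed V\<close>] C this open_UNIV]
    show ?thesis using that by (metis UNIV_I connected_component_refl mem_Collect_eq subsetD subset_UNIV)
  qed
  then obtain K where K: "\<And>x. x \<in> V \<Longrightarrow> openin (top_of_set V) (K x) \<and> compact (K x) \<and> x \<in> K x"
    by metis
  have "\<exists>O'. open O' \<and> K x = V \<inter> O'" if "x \<in> V" for x
    using K[OF that] by (auto simp: openin_open)
  then obtain W where W: "\<And>x. x \<in> V \<Longrightarrow> open (W x) \<and> K x = V \<inter> W x" by metis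
  have "compact (V \<inter> B)" using \<open>closed V\<close> \<open>compact B\<close> by (rule closed_Int_compact)
  moreover have "V \<inter> B \<subseteq> (\<Union>x\<in>V \<inter> B. W x)" using K W by blast
  ultimately obtain F where F: "F \<subseteq> V \<inter> B" "finite F" "V \<inter> B \<subseteq> (\<Union>x\<in>F. W x)"
    using compactE_image[of "V \<inter> B" "V \<inter> B" W] W by (metis IntD1)
  show thesis
  proof
    show "compact (\<Union>x\<in>F. K x)" using F K by (intro compact_UN) auto
    have "(\<Union>x\<in>F. K x) = V \<inter> (\<Union>x\<in>F. W x)" using F(1) W by (simp add: subset_iff)
    then have "V - (\<Union>x\<in>F. K x) = V - (\<Union>x\<in>F. W x)" by blast
    moreover have "open (\<Union>x\<in>F. W x)" using F W by (intro open_UN) auto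
    ultimately show "closed (V - (\<Union>x\<in>F. K x))" using \<open>closed V\<close> by (simp add: closed_Diff)
    show "V \<inter> B \<subseteq> (\<Union>x\<in>F. K x)" using F W by blast
    show "(\<Union>x\<in>F. K x) \<subseteq> V" using F W by blast
  qed
qed

text \<open>
  The arc plays the role of a circuit in the complement of \<open>V\<close> around the ball of radius \<open>R\<close>. Split \<open>V\<close>
  into a compact part \<open>U\<close>, which contains all of \<open>V\<close> in that ball, and a closed rest. The ball
  together with \<open>U\<close>, and the rest together with a neighbourhood of infinity, are disjoint closed sets.
  The points equidistant from both separate the origin from infinity, hence so does a single
  component \<open>C\<close> of this set of points. Such a \<open>C\<close> meets both halves of the horizontal axis,
  and a path through the open complement of \<open>V\<close> joins the two meeting points.
\<close>

lemma bounded_components_imp_complement_arc: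
  fixes V :: "(real \<times> real) set"
  assumes "closed V" and "\<And>C. C \<in> components V \<Longrightarrow> bounded C" and "0 \<le> R"
  obtains g t s where "path g" "path_image g \<subseteq> - V"
    "pathstart g = (t, 0)" "pathfinish g = (- s, 0)" "R < t" "0 \<le> s"
proof -
  obtain U where U: "compact U" "closed (V - U)" "V \<inter> cball 0 R \<subseteq> U" "U \<subseteq> V"
    using bounded_components_imp_compact_clopen[OF assms(1,2), of "cball 0 R"] by auto
  define A where "A = U \<union> cball 0 R"
  have "compact A" using U by (auto simp: A_def intro: compact_Un)
  then obtain m where m: "A \<subseteq> ball 0 m" "0 < m"
    using compact_imp_bounded bounded_subset_ballD by blast
  define B where "B = (V - U) \<union> - ball 0 m"
  have B: "closed B" using U by (auto simp: B_def closed_Compl)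
  have "closed A" using \<open>compact A\<close> by (rule compact_imp_closed)
  have AB: "A \<inter> B = {}" using m U by (auto simp: A_def B_def)
  have VAB: "V \<subseteq> A \<union> B" using U by (auto simp: A_def B_def)
  define b where "b = (m, 0::real)"
  have nb: "norm b = m" "norm (- b) = m" using m by (simp_all add: b_def)
  have "0 \<in> A" "b \<in> B" using nb assms(3) by (simp_all add: A_def B_def)
  have ne: "A \<noteq> {}" "B \<noteq> {}" using \<open>0 \<in> A\<close> \<open>b \<in> B\<close> by auto
  \<comment> \<open>\<open>S\<close> is closed, separates \<open>A\<close> from \<open>B\<close> and misses both, hence also \<open>V\<close>.\<close>
  define S where "S = {x. infdist x A = infdist x B}"
  have "closed S" unfolding S_def by (intro closed_Collect_eq continuous_intros)
  have A0: "infdist x A = 0 \<longleftrightarrow> x \<in> A" and B0: "infdist x B = 0 \<longleftrightarrow> x \<in> B" for x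
    using in_closed_iff_infdist_zero \<open>closed A\<close> B ne by metis+
  have SAB: "S \<inter> (A \<union> B) = {}"
    using A0 B0 AB by (fastforce simp: S_def)
  have "\<not> connected_component (- S) 0 b"
  proof
    assume "connected_component (- S) 0 b"
    then obtain T where T: "connected T" "T \<subseteq> - S" "0 \<in> T" "b \<in> T"
      by (auto simp: connected_component_def)
    let ?d = "\<lambda>x. infdist x A - infdist x B"
    have "connected (?d ` T)"
      by (intro connected_continuous_image continuous_intros T)
    moreover have "?d 0 \<le> 0" "0 \<le> ?d b"
      using A0 B0 \<open>0 \<in> A\<close> \<open>b \<in> B\<close> infdist_nonneg by (metis diff_le_0_iff_le, metis diff_ge_0_iff_ge)
    ultimately have "0 \<in> ?d ` T"
      using T(3,4) connectedD_interval[of "?d ` T" "?d 0" "?d b" 0] by blast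
    then show False using T(2) by (auto simp: S_def)
  qed
  then obtain C where C: "C \<in> components S" "\<not> connected_component (- C) 0 b"
    using separation_by_component_closed_pointwise[OF \<open>closed S\<close>] by metis
  have "C \<subseteq> S" using C(1) by (rule in_components_subset)
  have CV: "C \<subseteq> - V" using \<open>C \<subseteq> S\<close> SAB VAB by blast
  have hit: "\<exists>t\<in>{0..1}. t *\<^sub>R v \<in> C" if "v \<in> {b, - b}" for v
  proof (rule ccontr)
    assume "\<not> ?thesis"
    then have "closed_segment 0 v \<subseteq> - C" by (auto simp: closed_segment_def)
    then have *: "connected_component (- C) 0 v"
      unfolding connected_component_def by (meson connected_segment ends_in_segment)
    \<comment> \<open>For the left half axis: \<open>- b\<close> is joined to \<open>b\<close> outside \<open>C\<close> by the large circle.\<close>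
    have "connected (sphere (0::real \<times> real) m)"
      by (intro path_connected_imp_connected path_connected_sphere) simp
    moreover have "sphere 0 m \<subseteq> - C"
      using SAB \<open>C \<subseteq> S\<close> by (auto simp: B_def)
    ultimately have "connected_component (- C) v b"
      unfolding connected_component_def using nb that
      by (intro exI[of _ "sphere 0 m"]) auto
    with * C(2) show False using connected_component_trans by blast
  qed
  obtain t where t: "t \<in> {0..1}" "t *\<^sub>R b \<in> C" using hit by blast
  obtain s where s: "s \<in> {0..1}" "s *\<^sub>R (- b) \<in> C" using hit by blast
  have "R < t * m"
  proof (rule ccontr)
    assume "\<not> R < t * m"
    then have "t *\<^sub>R b \<in> A" using t(1) nb by (simp add: A_def)
    then show False using t(2) \<open>C \<subseteq> S\<close> SAB by blast
  qed
  have "open (- V)" using assms(1) by auto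
  have "connected_component (- V) (t *\<^sub>R b) (s *\<^sub>R (- b))"
    unfolding connected_component_def using C(1) CV s t in_components_connected by blast
  then have "path_component (- V) (t *\<^sub>R b) (s *\<^sub>R (- b))"
    using path_component_eq_connected_component[OF open_imp_locally_path_connected[OF \<open>open (- V)\<close>]] by auto
  then obtain g where "path g" "path_image g \<subseteq> - V" "pathstart g = t *\<^sub>R b" "pathfinish g = s *\<^sub>R (- b)"
    unfolding path_component_def by auto
  then show thesis
    using that[of g "t * m" "s * m"] \<open>R < t * m\<close> s(1) m(2) by (simp add: b_def)
qed

section \<open>The law of a Poisson process through its avoidance probabilities\<close>

definition avoiding :: "'e set \<Rightarrow> 'e set set" where
  "avoiding A = {\<eta>. \<eta> \<inter> A = {}}"

definition config_algebra :: "'e measure \<Rightarrow> 'e set measure" where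
  "config_algebra \<nu> = sigma UNIV (avoiding ` sets \<nu>)"

lemma sets_config_algebra: "sets (config_algebra \<nu>) = sigma_sets UNIV (avoiding ` sets \<nu>)"
  and space_config_algebra [simp]: "space (config_algebra \<nu>) = UNIV"
  by (simp_all add: config_algebra_def sets_measure_of space_measure_of)

lemma avoiding_in_config_algebra [intro]: "A \<in> sets \<nu> \<Longrightarrow> avoiding A \<in> sets (config_algebra \<nu>)"
  by (auto simp: sets_config_algebra)

lemma avoiding_Int: "avoiding A \<inter> avoiding B = avoiding (A \<union> B)"
  by (auto simp: avoiding_def)

lemma Int_stable_avoiding:
  assumes "\<And>A B. A \<in> \<A> \<Longrightarrow> B \<in> \<A> \<Longrightarrow> A \<union> B \<in> \<A>"
  shows "Int_stable (avoiding ` \<A>)"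
  using assms by (auto simp: Int_stable_def avoiding_Int)

text \<open>
  For a Poisson process of intensity \<open>\<nu>\<close>, the probability of having no point in \<open>A\<close>. The case of infinite
  mass is separate because \<open>measure\<close> is \<open>0\<close> there.
\<close>

definition avoidance_prob :: "'e measure \<Rightarrow> 'e set \<Rightarrow> real" where
  "avoidance_prob \<nu> A = (if emeasure \<nu> A = \<infinity> then 0 else exp (- measure \<nu> A))"

lemma avoidance_prob_Un:
  assumes "A \<in> sets \<nu>" "B \<in> sets \<nu>" "A \<inter> B = {}"
  shows "avoidance_prob \<nu> (A \<union> B) = avoidance_prob \<nu> A * avoidance_prob \<nu> B"
proof (cases "emeasure \<nu> A = \<infinity> \<or> emeasure \<nu> B = \<infinity>")
  case True
  moreover have "emeasure \<nu> (A \<union> B) = emeasure \<nu> A + emeasure \<nu> B"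
    using plus_emeasure[OF assms] by simp
  ultimately show ?thesis by (auto simp: avoidance_prob_def)
next
  case False
  moreover have "emeasure \<nu> (A \<union> B) = emeasure \<nu> A + emeasure \<nu> B"
    using plus_emeasure[OF assms] by simp
  moreover have "measure \<nu> (A \<union> B) = measure \<nu> A + measure \<nu> B"
    using False assms by (intro measure_Union) auto
  ultimately show ?thesis by (simp add: avoidance_prob_def mult_exp_exp)
qed

text \<open>
  The distribution, on the space of configurations, of a Poisson process of intensity \<open>\<nu>\<close>, specified by
  avoidance probabilities alone.
\<close>

locale avoidance_law = prob_space Q for Q :: "'e set measure" and \<nu> :: "'e measure" +
  assumes sets_Q: "sets Q = sets (config_algebra \<nu>)"
    and prob_avoiding: "A \<in> sets \<nu> \<Longrightarrow> prob (avoiding A) = avoidance_prob \<nu> A"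
begin

lemma space_Q [simp]: "space Q = UNIV"
  using sets_eq_imp_space_eq[OF sets_Q] by simp

lemma avoiding_event [intro, simp]: "A \<in> sets \<nu> \<Longrightarrow> avoiding A \<in> events"
  by (auto simp: sets_Q)

lemma prob_not_avoiding_le:
  assumes "A \<in> sets \<nu>" "emeasure \<nu> A < \<infinity>"
  shows "prob (- avoiding A) \<le> measure \<nu> A"
proof -
  have "prob (- avoiding A) = 1 - exp (- measure \<nu> A)"
    using prob_compl[of "avoiding A"] assms
    by (simp add: Compl_eq_Diff_UNIV[symmetric] prob_avoiding avoidance_prob_def)
  then show ?thesis using exp_ge_add_one_self[of "- measure \<nu> A"] by linarith
qed

text \<open>
  The avoidance events of subsets of \<open>D\<close> form an intersection-stable generator, likewise those of \<open>E\<close>.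
  On these generators independence is the multiplicativity of the avoidance probabilities.
\<close>

lemma indep_disjoint_regions:
  assumes "D \<in> sets \<nu>" "E \<in> sets \<nu>" "D \<inter> E = {}"
    and X: "X \<in> sigma_sets UNIV (avoiding ` {A \<in> sets \<nu>. A \<subseteq> D})"
    and Y: "Y \<in> sigma_sets UNIV (avoiding ` {A \<in> sets \<nu>. A \<subseteq> E})"
  shows "prob (X \<inter> Y) = prob X * prob Y"
proof -
  let ?G = "\<lambda>D. avoiding ` {A \<in> sets \<nu>. A \<subseteq> D}"
  have "indep_set (?G D) (?G E)"
  proof (rule indep_setI)
    show "?G D \<subseteq> events" "?G E \<subseteq> events" by auto
    fix a b assume "a \<in> ?G D" "b \<in> ?G E"
    then obtain A B where AB: "A \<in> sets \<nu>" "B \<in> sets \<nu>" "A \<subseteq> D" "B \<subseteq> E" "a = avoiding A" "b = avoiding B"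
      by auto
    then have "A \<inter> B = {}" using assms(3) by auto
    with AB show "prob (a \<inter> b) = prob a * prob b"
      by (simp add: avoiding_Int prob_avoiding avoidance_prob_Un)
  qed
  then have "indep_set (sigma_sets (space Q) (?G D)) (sigma_sets (space Q) (?G E))"
    by (intro indep_set_sigma_sets Int_stable_avoiding) auto
  then show ?thesis using X Y by (auto simp: indep_sets2_eq)
qed

end

text \<open>
  A case of Renyi's theorem: avoidance events are closed under intersection and generate the algebra.
\<close>

lemma avoidance_law_unique:
  assumes "avoidance_law Q \<nu>" "avoidance_law Q' \<nu>"
  shows "Q = Q'"
proof -
  interpret Q: avoidance_law Q \<nu> by fact
  interpret Q': avoidance_law Q' \<nu> by fact
  show ?thesis
  proof (rule measure_eqI_generator_eq[where E = "avoiding ` sets \<nu>" and A = "\<lambda>_. avoiding {}"])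
    show "Int_stable (avoiding ` sets \<nu>)" by (rule Int_stable_avoiding) auto
    show "emeasure Q X = emeasure Q' X" if "X \<in> avoiding ` sets \<nu>" for X
      using that by (auto simp: Q.emeasure_eq_measure Q'.emeasure_eq_measure Q.prob_avoiding Q'.prob_avoiding)
    show "sets Q = sigma_sets UNIV (avoiding ` sets \<nu>)" "sets Q' = sigma_sets UNIV (avoiding ` sets \<nu>)"
      by (simp_all add: Q.sets_Q Q'.sets_Q sets_config_algebra)
    show "(\<Union>i::nat. avoiding {}) = (UNIV :: 'a set set)" by (auto simp: avoiding_def)
    show "range (\<lambda>_::nat. avoiding {}) \<subseteq> avoiding ` sets \<nu>" by blast
    show "emeasure Q (avoiding {}) \<noteq> \<infinity>" for i :: nat by simp
  qed simp
qed

text \<open>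
  The image configuration avoids \<open>A\<close> exactly when the configuration avoids \<open>T -` A\<close>, so the image
  has the same avoidance probabilities and uniqueness applies.
\<close>

lemma (in avoidance_law) distr_image_eq:
  assumes pre: "\<And>A. A \<in> sets \<nu> \<Longrightarrow> T -` A \<in> sets \<nu> \<and> emeasure \<nu> (T -` A) = emeasure \<nu> A"
  shows "image T \<in> Q \<rightarrow>\<^sub>M Q" "distr Q Q (image T) = Q"
proof -
  have vim: "image T -` avoiding A = avoiding (T -` A)" for A
    by (auto simp: avoiding_def)
  show meas: "image T \<in> Q \<rightarrow>\<^sub>M Q"
    by (rule measurable_sigma_sets[of Q UNIV "avoiding ` sets \<nu>"])
       (auto simp: sets_Q vim pre sets_config_algebra[symmetric] intro!: avoiding_in_config_algebra)
  interpret P: prob_space "distr Q Q (image T)" using meas by (rule prob_space_distr)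
  have "avoidance_law (distr Q Q (image T)) \<nu>"
  proof unfold_locales
    fix A assume A: "A \<in> sets \<nu>"
    have "measure (distr Q Q (image T)) (avoiding A) = prob (avoiding (T -` A))"
      using A by (simp add: measure_distr[OF meas] vim)
    also have "\<dots> = avoidance_prob \<nu> A"
      using pre[OF A] by (auto simp: prob_avoiding avoidance_prob_def measure_def[of \<nu>])
    finally show "measure (distr Q Q (image T)) (avoiding A) = avoidance_prob \<nu> A" .
  next
    show "sets (distr Q Q (image T)) = sets (config_algebra \<nu>)" by (simp add: sets_Q)
  qed
  then show "distr Q Q (image T) = Q"
    using avoidance_law_unique avoidance_law_axioms by blast
qed

lemma avoidance_law_distr_poisson:
  assumes "poisson_point_process M \<nu> \<omega>"
  shows "\<omega> \<in> M \<rightarrow>\<^sub>M config_algebra \<nu>" "avoidance_law (distr M (config_algebra \<nu>) \<omega>) \<nu>"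
proof -
  have M: "prob_space M"
    and cnt: "\<And>A. A \<in> sets \<nu> \<Longrightarrow> (\<lambda>w. point_count (\<omega> w) A) \<in> borel_measurable M"
    and fin: "\<And>A. A \<in> sets \<nu> \<Longrightarrow> emeasure \<nu> A < \<infinity> \<Longrightarrow>
      measure M {w\<in>space M. point_count (\<omega> w) A = of_nat 0} = exp (- measure \<nu> A) * measure \<nu> A ^ 0 / fact 0"
    and inf: "\<And>A. A \<in> sets \<nu> \<Longrightarrow> emeasure \<nu> A = \<infinity> \<Longrightarrow> AE w in M. point_count (\<omega> w) A = \<infinity>"
    using assms unfolding poisson_point_process_def by blast+
  interpret prob_space M by fact
  have zero: "point_count \<eta> A = 0 \<longleftrightarrow> \<eta> \<in> avoiding A" for \<eta> A
    by (simp add: point_count_def avoiding_def emeasure_count_space_eq_0)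
  have vim: "\<omega> -` avoiding A \<inter> space M = {w\<in>space M. point_count (\<omega> w) A = 0}" for A
    using zero by auto
  show meas: "\<omega> \<in> M \<rightarrow>\<^sub>M config_algebra \<nu>"
    unfolding config_algebra_def
  proof (rule measurable_measure_of)
    fix X assume "X \<in> avoiding ` sets \<nu>"
    then obtain A where A: "A \<in> sets \<nu>" "X = avoiding A" by auto
    show "\<omega> -` X \<inter> space M \<in> events"
      unfolding A(2) vim using cnt[OF A(1)] by measurable
  qed auto
  interpret P: prob_space "distr M (config_algebra \<nu>) \<omega>" using meas by (rule prob_space_distr)
  show "avoidance_law (distr M (config_algebra \<nu>) \<omega>) \<nu>"
  proof unfold_locales
    fix A assume A: "A \<in> sets \<nu>"
    have eq: "measure (distr M (config_algebra \<nu>) \<omega>) (avoiding A) = prob {w\<in>space M. point_count (\<omega> w) A = 0}"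
      using A by (simp add: measure_distr[OF meas] avoiding_in_config_algebra vim)
    show "measure (distr M (config_algebra \<nu>) \<omega>) (avoiding A) = avoidance_prob \<nu> A"
    proof (cases "emeasure \<nu> A = \<infinity>")
      case True
      have "AE w in M. \<not> point_count (\<omega> w) A = 0" using inf[OF A True] by eventually_elim simp
      then have "prob {w\<in>space M. point_count (\<omega> w) A = 0} = 0"
        using cnt[OF A] by (subst prob_eq_0) auto
      then show ?thesis using True eq by (simp add: avoidance_prob_def)
    next
      case False
      then show ?thesis using fin[OF A] eq by (simp add: avoidance_prob_def top.not_eq_extremum)
    qed
  next
    show "sets (distr M (config_algebra \<nu>) \<omega>) = sets (config_algebra \<nu>)" by simp
  qed
qed

section \<open>Occupied compact sets and measurability\<close>

lemma in_occupied_iff: "v \<in> occupied \<eta> \<longleftrightarrow> (\<exists>x z. (x, z) \<in> \<eta> \<and> dist x v < z)"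
  unfolding occupied_def by (simp add: split_beta' Bex_def)

lemma occupied_mono: "\<eta> \<subseteq> \<zeta> \<Longrightarrow> occupied \<eta> \<subseteq> occupied \<zeta>"
  by (auto simp: occupied_def)

lemma open_occupied: "open (occupied \<eta>)"
  by (auto simp: occupied_def split_beta)

text \<open>
  Being covered by the occupied set is an open condition: finitely many balls cover \<open>K\<close> with room to spare, so
  their centres and radii may move within small basic open sets.
\<close>

lemma occupied_witnesses:
  assumes "compact K" "K \<subseteq> occupied \<eta>" and basis: "topological_basis \<B>"
  obtains F where "finite F" "F \<subseteq> \<B>" "\<forall>B\<in>F. \<eta> \<inter> B \<noteq> {}"
    "\<forall>\<zeta>. (\<forall>B\<in>F. \<zeta> \<inter> B \<noteq> {}) \<longrightarrow> K \<subseteq> occupied \<zeta>"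
proof -
  have "\<exists>B e. B \<in> \<B> \<and> \<eta> \<inter> B \<noteq> {} \<and> 0 < e \<and> (\<forall>(x, z)\<in>B. ball p e \<subseteq> ball x z)" if "p \<in> K" for p
  proof -
    have "p \<in> occupied \<eta>" using that assms(2) by (rule subsetD[rotated])
    then obtain x z where xz: "(x, z) \<in> \<eta>" "dist x p < z"
      unfolding in_occupied_iff by (elim exE conjE)
    \<comment> \<open>One third of the slack goes to the centre, one to the radius and one to the neighbourhood of \<open>p\<close>.\<close>
    define e where "e = (z - dist x p) / 3"
    have "0 < e" using xz by (simp add: e_def)
    obtain B where B: "B \<in> \<B>" "(x, z) \<in> B" "B \<subseteq> ball (x, z) e"
      using topological_basisE[OF basis open_ball, of "(x, z)" "(x, z)" e] \<open>0 < e\<close> by auto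
    have "ball p e \<subseteq> ball x' z'" if "(x', z') \<in> B" for x' z'
    proof
      fix v assume v: "v \<in> ball p e"
      have "dist (x, z) (x', z') < e" using B(3) that by auto
      then have "dist x x' < e" "dist z z' < e"
        using dist_fst_le[of "(x, z)" "(x', z')"] dist_snd_le[of "(x, z)" "(x', z')"] by auto
      moreover have "dist x' v \<le> dist x x' + dist x p + dist p v"
        using dist_triangle[of x' v x] dist_triangle[of x v p] by (simp add: dist_commute)
      moreover have "dist p v < e" "3 * e = z - dist x p" using v by (simp_all add: e_def)
      moreover have "z - z' < e" using \<open>dist z z' < e\<close> by (simp add: dist_real_def)
      ultimately have "dist x' v < z'" by linarith
      then show "v \<in> ball x' z'" by simp
    qed
    then show ?thesis using B xz \<open>0 < e\<close> by blast
  qed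
  then obtain B e where Be: "\<And>p. p \<in> K \<Longrightarrow> B p \<in> \<B> \<and> \<eta> \<inter> B p \<noteq> {} \<and> 0 < e p \<and> (\<forall>(x, z)\<in>B p. ball p (e p) \<subseteq> ball x z)"
    by metis
  have "K \<subseteq> (\<Union>p\<in>K. ball p (e p))" using Be by force
  then obtain L where L: "L \<subseteq> K" "finite L" "K \<subseteq> (\<Union>p\<in>L. ball p (e p))"
    using compactE_image[OF \<open>compact K\<close>, of K "\<lambda>p. ball p (e p)"] by auto
  have cover: "K \<subseteq> occupied \<zeta>" if \<zeta>: "\<forall>p\<in>L. \<zeta> \<inter> B p \<noteq> {}" for \<zeta>
  proof
    fix v assume "v \<in> K"
    then obtain p where p: "p \<in> L" "v \<in> ball p (e p)" using L(3) by blast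
    then obtain b where b: "b \<in> \<zeta>" "b \<in> B p" using \<zeta> by blast
    have "ball p (e p) \<subseteq> ball (fst b) (snd b)" using Be[of p] p(1) L(1) b(2) by fastforce
    then have "dist (fst b) v < snd b" using p(2) by auto
    then show "v \<in> occupied \<zeta>" using b(1) unfolding in_occupied_iff by (metis prod.collapse)
  qed
  show thesis
  proof (rule that[of "B ` L"])
    show "finite (B ` L)" using L(2) by simp
    show "B ` L \<subseteq> \<B>" "\<forall>A\<in>B ` L. \<eta> \<inter> A \<noteq> {}" using Be L(1) by blast+
    show "\<forall>\<zeta>. (\<forall>A\<in>B ` L. \<zeta> \<inter> A \<noteq> {}) \<longrightarrow> K \<subseteq> occupied \<zeta>" using cover by blast
  qed
qed

text \<open>
  By \<open>occupied_witnesses\<close>, the event is a countable union, over finite sets \<open>F\<close> of basic open sets, of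
  the events that every member of \<open>F\<close> contains a point. The region \<open>D\<close> makes the events local: only
  avoidance events of sets \<open>B \<inter> D\<close> occur.
\<close>

lemma covering_in_sigma_sets:
  assumes compact: "\<And>K. K \<in> \<K> \<Longrightarrow> compact K"
    and \<A>: "\<And>B. open B \<Longrightarrow> B \<inter> D \<in> \<A>"
  shows "{\<eta>. \<exists>K\<in>\<K>. K \<subseteq> occupied (\<eta> \<inter> D)} \<in> sigma_sets UNIV (avoiding ` \<A>)"
proof -
  obtain \<B> :: "((real \<times> real) \<times> real) set set" where \<B>: "countable \<B>" "topological_basis \<B>"
    using ex_countable_basis by blast
  define \<F> where "\<F> = {F. finite F \<and> F \<subseteq> \<B> \<and> (\<forall>\<zeta>. (\<forall>B\<in>F. \<zeta> \<inter> B \<noteq> {}) \<longrightarrow> (\<exists>K\<in>\<K>. K \<subseteq> occupied \<zeta>))}"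
  have "\<F> \<subseteq> {F. finite F \<and> F \<subseteq> \<B>}" unfolding \<F>_def by blast
  then have "countable \<F>" using countable_Collect_finite_subset[OF \<B>(1)] by (rule countable_subset)
  have eq: "(\<exists>K\<in>\<K>. K \<subseteq> occupied \<zeta>) \<longleftrightarrow> (\<exists>F\<in>\<F>. \<forall>B\<in>F. \<zeta> \<inter> B \<noteq> {})" for \<zeta>
  proof
    assume "\<exists>K\<in>\<K>. K \<subseteq> occupied \<zeta>"
    then obtain K where K: "K \<in> \<K>" "K \<subseteq> occupied \<zeta>" by (rule bexE)
    obtain F where F: "finite F" "F \<subseteq> \<B>" "\<forall>B\<in>F. \<zeta> \<inter> B \<noteq> {}"
      "\<forall>\<zeta>. (\<forall>B\<in>F. \<zeta> \<inter> B \<noteq> {}) \<longrightarrow> K \<subseteq> occupied \<zeta>"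
      by (rule occupied_witnesses[OF compact[OF K(1)] K(2) \<B>(2)])
    have "F \<in> \<F>" using F(1,2,4) K(1) unfolding \<F>_def by blast
    then show "\<exists>F\<in>\<F>. \<forall>B\<in>F. \<zeta> \<inter> B \<noteq> {}" using F(3) by blast
  next
    assume "\<exists>F\<in>\<F>. \<forall>B\<in>F. \<zeta> \<inter> B \<noteq> {}"
    then show "\<exists>K\<in>\<K>. K \<subseteq> occupied \<zeta>" unfolding \<F>_def by blast
  qed
  define N where "N = sigma (UNIV :: ((real \<times> real) \<times> real) set set) (avoiding ` \<A>)"
  have N: "sets N = sigma_sets UNIV (avoiding ` \<A>)" "space N = UNIV"
    by (simp_all add: N_def sets_measure_of space_measure_of)
  have "{\<eta>\<in>space N. \<exists>F\<in>\<F>. \<forall>B\<in>F. \<eta> \<inter> D \<inter> B \<noteq> {}} \<in> sets N"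
  proof (intro sets.sets_Collect_countable_Ex' \<open>countable \<F>\<close>)
    fix F assume "F \<in> \<F>"
    then have F: "finite F" "\<And>B. B \<in> F \<Longrightarrow> open B"
      using topological_basis_open[OF \<B>(2)] by (auto simp: \<F>_def)
    show "{\<eta>\<in>space N. \<forall>B\<in>F. \<eta> \<inter> D \<inter> B \<noteq> {}} \<in> sets N"
    proof (intro sets.sets_Collect_finite_All \<open>finite F\<close>)
      fix B assume "B \<in> F"
      have "{\<eta>\<in>space N. \<eta> \<inter> D \<inter> B \<noteq> {}} = space N - avoiding (B \<inter> D)"
        by (auto simp: avoiding_def N)
      moreover have "avoiding (B \<inter> D) \<in> sets N" using \<A>[OF F(2)[OF \<open>B \<in> F\<close>]] by (auto simp: N)
      ultimately show "{\<eta>\<in>space N. \<eta> \<inter> D \<inter> B \<noteq> {}} \<in> sets N" by auto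
    qed
  qed
  then show ?thesis by (simp add: eq N)
qed

lemma occupied_nonneg_radii: "occupied (\<eta> \<inter> UNIV \<times> {0..}) = occupied \<eta>"
proof -
  have "dist x v < z \<longleftrightarrow> 0 \<le> z \<and> dist x v < z" for x v :: "real \<times> real" and z
    using zero_le_dist[of x v] by linarith
  then have "v \<in> occupied (\<eta> \<inter> UNIV \<times> {0..}) \<longleftrightarrow> v \<in> occupied \<eta>" for v
    unfolding in_occupied_iff by (simp only: Int_iff mem_Times_iff UNIV_I fst_conv snd_conv atLeast_iff) blast
  then show ?thesis by blast
qed

section \<open>Arms across annuli\<close>

lemma continuous_on_dist_point: "continuous_on UNIV (dist (y :: 'a::metric_space))"
  by (intro continuous_intros)

text \<open>
  The factor \<open>6\<close> makes an arm leave the square of half side \<open>3 * l\<close> around \<open>y\<close>, as the comparison with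
  rectangles of aspect ratio \<open>3\<close> requires.
\<close>

definition arm :: "((real \<times> real) \<times> real) set \<Rightarrow> real \<times> real \<Rightarrow> real \<Rightarrow> bool" where
  "arm \<eta> y l \<longleftrightarrow> (\<exists>g. path g \<and> path_image g \<subseteq> occupied \<eta> \<and>
     dist y (pathstart g) \<le> l \<and> 6 * l \<le> dist y (pathfinish g))"

text \<open>
  The balls of radius at most \<open>s\<close> that meet the ball of radius \<open>6 * l\<close> around \<open>y\<close>; they decide whether there is
  an arm made of balls of radius at most \<open>s\<close>.
\<close>

definition reach :: "real \<times> real \<Rightarrow> real \<Rightarrow> real \<Rightarrow> ((real \<times> real) \<times> real) set" where
  "reach y l s = {(x, z). dist y x < 6 * l + z \<and> 0 \<le> z \<and> z \<le> s}"

lemma arm_mono: "arm \<eta> y l \<Longrightarrow> \<eta> \<subseteq> \<zeta> \<Longrightarrow> arm \<zeta> y l"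
  unfolding arm_def using occupied_mono by blast

text \<open>
  A portion of the arm stays within distance \<open>6 * l\<close> of \<open>y\<close>, so balls that stay away from this
  neighbourhood are irrelevant.
\<close>

lemma arm_local:
  assumes "arm \<eta> y l" "0 \<le> l" and rad: "\<And>x z. (x, z) \<in> \<eta> \<Longrightarrow> 0 \<le> z \<Longrightarrow> dist y x < 6 * l + z \<Longrightarrow> z \<le> s"
  shows "arm (\<eta> \<inter> reach y l s) y l"
proof -
  obtain g where g: "path g" "path_image g \<subseteq> occupied \<eta>"
    "dist y (pathstart g) \<le> l" "6 * l \<le> dist y (pathfinish g)"
    using assms(1) by (auto simp: arm_def)
  obtain h where h: "path h" "path_image h \<subseteq> path_image g"
    "dist y (pathstart h) = l" "dist y (pathfinish h) = 6 * l"
    "\<forall>p\<in>path_image h. l \<le> dist y p \<and> dist y p \<le> 6 * l"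
    using \<open>0 \<le> l\<close> by (auto intro: subpath_between_levels[OF g(1) continuous_on_dist_point g(3,4)])
  have "path_image h \<subseteq> occupied (\<eta> \<inter> reach y l s)"
  proof
    fix p assume p: "p \<in> path_image h"
    then have "p \<in> occupied \<eta>" using h(2) g(2) by blast
    then obtain x z where xz: "(x, z) \<in> \<eta>" "dist x p < z"
      unfolding in_occupied_iff by (elim exE conjE)
    have "0 \<le> z" using xz(2) zero_le_dist[of x p] by linarith
    moreover have "dist y x < 6 * l + z"
      using bspec[OF h(5) p] xz(2) dist_triangle[of y x p] by (simp add: dist_commute)
    ultimately show "p \<in> occupied (\<eta> \<inter> reach y l s)"
      using xz rad[of x z] unfolding in_occupied_iff reach_def by blast
  qed
  then show ?thesis using h by (auto simp: arm_def)
qed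

text \<open>
  The five-fold arm has a portion from distance \<open>5 * l\<close> to distance \<open>30 * l\<close> from \<open>y\<close>. Its ends are \<open>25 * l\<close>
  apart, and each lies within \<open>l\<close> of one of the finitely many points \<open>y + l *\<^sub>R p\<close>. This
  point then sees an arm, because the other end is far away. The separation \<open>23 * l\<close> exceeds twice
  \<open>6 * l + 5 * l\<close>, so the two arms are independent once the radii are at most \<open>5 * l\<close>.
\<close>

lemma arm_splits:
  assumes "arm \<eta> y (5 * l)" "0 < l" and cover: "cball 0 35 \<subseteq> (\<Union>p\<in>P. cball p 1)"
  obtains p q where "p \<in> P" "q \<in> P" "arm \<eta> (y + l *\<^sub>R p) l" "arm \<eta> (y + l *\<^sub>R q) l"
    "23 * l \<le> dist (y + l *\<^sub>R p) (y + l *\<^sub>R q)"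
proof -
  obtain g where g: "path g" "path_image g \<subseteq> occupied \<eta>"
    "dist y (pathstart g) \<le> 5 * l" "6 * (5 * l) \<le> dist y (pathfinish g)"
    using assms(1) by (auto simp: arm_def)
  obtain h where h: "path h" "path_image h \<subseteq> path_image g"
    "dist y (pathstart h) = 5 * l" "dist y (pathfinish h) = 30 * l"
    "\<forall>p\<in>path_image h. 5 * l \<le> dist y p \<and> dist y p \<le> 30 * l"
    by (rule subpath_between_levels[OF g(1) continuous_on_dist_point g(3), of "30 * l"])
       (use g(4) \<open>0 < l\<close> in simp_all)
  have near: "\<exists>p\<in>P. dist (y + l *\<^sub>R p) v \<le> l" if "dist y v \<le> 30 * l" for v
  proof -
    have "norm ((v - y) /\<^sub>R l) = dist y v / l"
      using \<open>0 < l\<close> by (simp add: dist_norm norm_minus_commute divide_inverse_commute)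
    also have "\<dots> \<le> 30" using that \<open>0 < l\<close> by (simp add: pos_divide_le_eq)
    finally have "norm ((v - y) /\<^sub>R l) \<le> 35" by simp
    then have "(v - y) /\<^sub>R l \<in> (\<Union>p\<in>P. cball p 1)" by (intro subsetD[OF cover]) simp
    then obtain p where p: "p \<in> P" "dist p ((v - y) /\<^sub>R l) \<le> 1" by (metis UN_E mem_cball)
    have "(y + l *\<^sub>R p) - v = l *\<^sub>R (p - (v - y) /\<^sub>R l)" using \<open>0 < l\<close> by (simp add: algebra_simps)
    then have "dist (y + l *\<^sub>R p) v = l * dist p ((v - y) /\<^sub>R l)"
      using \<open>0 < l\<close> by (simp add: dist_norm)
    then show ?thesis using p \<open>0 < l\<close> by (intro bexI[of _ p]) (simp_all add: mult_left_le)
  qed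
  let ?a = "pathstart h" and ?b = "pathfinish h"
  have "dist y ?a \<le> 30 * l" using h(3) \<open>0 < l\<close> by simp
  from near[OF this] obtain p where p: "p \<in> P" "dist (y + l *\<^sub>R p) ?a \<le> l" by (rule bexE)
  have "dist y ?b \<le> 30 * l" using h(4) by simp
  from near[OF this] obtain q where q: "q \<in> P" "dist (y + l *\<^sub>R q) ?b \<le> l" by (rule bexE)
  have ab: "25 * l \<le> dist ?a ?b" using dist_triangle[of y ?b ?a] h by simp
  have pb: "24 * l \<le> dist (y + l *\<^sub>R p) ?b"
    using ab p(2) dist_triangle[of ?a ?b "y + l *\<^sub>R p"] by (simp add: dist_commute)
  have qa: "24 * l \<le> dist (y + l *\<^sub>R q) ?a"
    using ab q(2) dist_triangle[of ?a ?b "y + l *\<^sub>R q"] by (simp add: dist_commute)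
  have hocc: "path_image h \<subseteq> occupied \<eta>" using h g by blast
  have "arm \<eta> (y + l *\<^sub>R p) l"
    unfolding arm_def using h(1) hocc p(2) pb \<open>0 < l\<close> by (intro exI[of _ h]) auto
  moreover have "arm \<eta> (y + l *\<^sub>R q) l"
    unfolding arm_def using h(1) hocc q(2) qa \<open>0 < l\<close> by (intro exI[of _ "reversepath h"]) auto
  moreover have "23 * l \<le> dist (y + l *\<^sub>R p) (y + l *\<^sub>R q)"
    using pb q(2) dist_triangle[of "y + l *\<^sub>R p" ?b "y + l *\<^sub>R q"] by simp
  ultimately show thesis using that p q by blast
qed

lemma reach_borel: "reach y l s \<in> sets borel"
proof -
  have "reach y l s = {p. dist y (fst p) < 6 * l + snd p} \<inter> ({p. 0 \<le> snd p} \<inter> {p. snd p \<le> s})"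
    by (auto simp: reach_def)
  moreover have "{p::(real\<times>real)\<times>real. dist y (fst p) < 6 * l + snd p} \<in> sets borel"
    by (intro borel_open open_Collect_less continuous_intros)
  moreover have "{p::(real\<times>real)\<times>real. 0 \<le> snd p} \<in> sets borel" "{p::(real\<times>real)\<times>real. snd p \<le> s} \<in> sets borel"
    by (intro borel_closed closed_Collect_le continuous_intros)+
  ultimately show ?thesis by simp
qed

section \<open>From arms to crossings of rectangles\<close>

text \<open>
  The isometries that carry the four rectangles around the square of half side \<open>l\<close> centred at \<open>y\<close> to the
  rectangle with corners \<open>(0, 0)\<close> and \<open>(2 * l, 6 * l)\<close>, the side next to the square going to the left side: \<open>b\<close>
  selects the rectangles above and below, and \<open>s\<close> the side of the square.
\<close>

definition place :: "real \<Rightarrow> bool \<Rightarrow> real \<times> real \<Rightarrow> real \<Rightarrow> real \<times> real \<Rightarrow> real \<times> real" where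
  "place s b y l v = (- l, 3 * l) + s *\<^sub>R (if b then prod.swap (v - y) else v - y)"

lemma dist_place: "\<bar>s\<bar> = 1 \<Longrightarrow> dist (place s b y l v) (place s b y l w) = dist v w"
proof -
  assume s: "\<bar>s\<bar> = 1"
  have sw: "norm (prod.swap u) = norm u" for u :: "real \<times> real"
    by (simp add: norm_prod_def add.commute)
  have "place s b y l v - place s b y l w = s *\<^sub>R (if b then prod.swap (v - w) else v - w)"
    by (auto simp: place_def prod_eq_iff algebra_simps)
  then show ?thesis using s sw[of "v - w"] by (simp add: dist_norm)
qed

text \<open>
  In the supremum norm the arm runs from distance at most \<open>l\<close> to distance \<open>3 * l\<close>. The coordinate that
  reaches \<open>3 * l\<close> in absolute value passes from \<open>l\<close> to \<open>3 * l\<close>, up to sign, while the other one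
  stays at most \<open>3 * l\<close> in absolute value.
\<close>

lemma arm_imp_crossed:
  assumes "arm \<eta> y l" "0 < l"
  obtains s b where "s \<in> {1, - 1}" "crossed (map_prod (place s b y l) id ` \<eta>) (2 * l) (6 * l)"
proof -
  obtain g where g: "path g" "path_image g \<subseteq> occupied \<eta>"
    "dist y (pathstart g) \<le> l" "6 * l \<le> dist y (pathfinish g)"
    using assms(1) by (auto simp: arm_def)
  define N where "N v = max \<bar>fst (v - y)\<bar> \<bar>snd (v - y)\<bar>" for v
  have N1: "N v \<le> dist y v" for v
    using dist_fst_le[of v y] dist_snd_le[of v y] by (simp add: N_def dist_real_def dist_commute[of y])
  have N2: "dist y v \<le> 2 * N v" for v
  proof -
    have "norm (v - y) \<le> \<bar>fst (v - y)\<bar> + \<bar>snd (v - y)\<bar>"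
      using norm_Pair_le[of "fst (v - y)" "snd (v - y)"] by (simp only: prod.collapse real_norm_def)
    moreover have "\<bar>fst (v - y)\<bar> \<le> N v" "\<bar>snd (v - y)\<bar> \<le> N v" by (simp_all only: N_def max.cobounded1 max.cobounded2)
    ultimately show ?thesis by (simp add: dist_norm norm_minus_commute[of y])
  qed
  have "N (pathstart g) \<le> l" "3 * l \<le> N (pathfinish g)"
    using N1[of "pathstart g"] N2[of "pathfinish g"] g(3,4) by auto
  moreover have "continuous_on UNIV N" unfolding N_def by (intro continuous_intros)
  ultimately obtain h where h: "path h" "path_image h \<subseteq> path_image g"
    "N (pathstart h) = l" "N (pathfinish h) = 3 * l" "\<forall>p\<in>path_image h. l \<le> N p \<and> N p \<le> 3 * l"
    using \<open>0 < l\<close> by (auto intro: subpath_between_levels[OF g(1), of N l "3 * l"])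
  have "\<exists>s b. s \<in> {1, - 1} \<and> fst (place s b y l (pathfinish h)) = 2 * l"
  proof -
    let ?d = "pathfinish h - y"
    have "fst ?d = 3 * l \<or> - fst ?d = 3 * l \<or> snd ?d = 3 * l \<or> - snd ?d = 3 * l"
      using h(4) by (auto simp: N_def max_def abs_if split: if_splits)
    then show ?thesis
    proof (elim disjE)
      assume "fst ?d = 3 * l"
      then show ?thesis by (intro exI[of _ 1] exI[of _ False]) (simp add: place_def)
    next
      assume "- fst ?d = 3 * l"
      then show ?thesis by (intro exI[of _ "- 1"] exI[of _ False]) (simp add: place_def)
    next
      assume "snd ?d = 3 * l"
      then show ?thesis by (intro exI[of _ 1] exI[of _ True]) (simp add: place_def)
    next
      assume "- snd ?d = 3 * l"
      then show ?thesis by (intro exI[of _ "- 1"] exI[of _ True]) (simp add: place_def)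
    qed
  qed
  then obtain s b where s: "s \<in> {1, - 1}" and fin: "fst (place s b y l (pathfinish h)) = 2 * l" by blast
  let ?T = "place s b y l"
  have comp: "\<bar>fst (?T v) + l\<bar> \<le> N v" "\<bar>snd (?T v) - 3 * l\<bar> \<le> N v" for v
    using s by (auto simp: place_def N_def)
  have T: "continuous_on UNIV ?T"
    by (rule lipschitz_on_continuous_on[of 1]) (use s in \<open>auto simp: lipschitz_on_def dist_place\<close>)
  have "continuous_on UNIV (\<lambda>v. fst (?T v))" using T by (rule continuous_on_fst)
  moreover have "fst (?T (pathstart h)) \<le> 0" using comp(1)[of "pathstart h"] h(3) by auto
  ultimately obtain k where k: "path k" "path_image k \<subseteq> path_image h"
    "fst (?T (pathstart k)) = 0" "fst (?T (pathfinish k)) = 2 * l"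
    "\<forall>p\<in>path_image k. 0 \<le> fst (?T p) \<and> fst (?T p) \<le> 2 * l"
    using subpath_between_levels[OF h(1), of "\<lambda>v. fst (?T v)" 0 "2 * l"] fin \<open>0 < l\<close> by auto
  have box: "?T p \<in> {0..2 * l} \<times> {0..6 * l}" if "p \<in> path_image k" for p
  proof -
    have "0 \<le> fst (?T p)" "fst (?T p) \<le> 2 * l" using k(5) that by auto
    moreover have "\<bar>snd (?T p) - 3 * l\<bar> \<le> 3 * l" using comp(2)[of p] h(5) k(2) that by fastforce
    ultimately show ?thesis by (auto simp: mem_Times_iff abs_le_iff)
  qed
  have occ: "?T p \<in> occupied (map_prod ?T id ` \<eta>)" if "p \<in> path_image k" for p
  proof -
    have "p \<in> occupied \<eta>" using that k(2) h(2) g(2) by blast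
    then obtain x z where "(x, z) \<in> \<eta>" "dist x p < z"
      unfolding in_occupied_iff by (elim exE conjE)
    moreover from this(1) have "(?T x, z) \<in> map_prod ?T id ` \<eta>" by force
    moreover have "dist (?T x) (?T p) = dist x p" using s by (intro dist_place) auto
    ultimately show ?thesis unfolding in_occupied_iff by metis
  qed
  have "crossed (map_prod ?T id ` \<eta>) (2 * l) (6 * l)"
    unfolding crossed_def
  proof (intro exI[of _ "?T \<circ> k"] conjI)
    show "path (?T \<circ> k)" using k(1) T by (metis continuous_on_subset path_continuous_image subset_UNIV)
    show "path_image (?T \<circ> k) \<subseteq> occupied (map_prod ?T id ` \<eta>) \<inter> {0..2 * l} \<times> {0..6 * l}"
      unfolding path_image_compose using box occ by blast
    show "pathstart (?T \<circ> k) \<in> {0} \<times> {0..6 * l}"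
      using box[OF pathstart_in_path_image] k(3) by (simp add: pathstart_compose mem_Times_iff)
    show "pathfinish (?T \<circ> k) \<in> {2 * l} \<times> {0..6 * l}"
      using box[OF pathfinish_in_path_image] k(4) by (simp add: pathfinish_compose mem_Times_iff)
  qed
  then show thesis using that s by blast
qed

text \<open>
  An affine map with scaling factor of absolute value \<open>1\<close>, composed with a possible swap of coordinates,
  preserves Lebesgue measure.
\<close>

lemma distr_lborel_place:
  assumes "\<bar>s\<bar> = 1"
  shows "place s b y l \<in> borel_measurable borel" "distr lborel borel (place s b y l) = lborel"
proof -
  define c where "c = (- l, 3 * l) - s *\<^sub>R (if b then prod.swap y else y)"
  define \<sigma> where "\<sigma> v = (if b then prod.swap v else v)" for v :: "real \<times> real"
  have eq: "place s b y l = (\<lambda>v. c + s *\<^sub>R v) \<circ> \<sigma>"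
    by (auto simp: place_def c_def \<sigma>_def fun_eq_iff prod_eq_iff algebra_simps)
  have "continuous_on UNIV \<sigma>"
    by (cases b) (auto simp: \<sigma>_def[abs_def] prod.swap_def[abs_def] intro!: continuous_on_Pair continuous_on_fst continuous_on_snd continuous_on_id)
  then have \<sigma>: "\<sigma> \<in> borel_measurable borel" by (rule borel_measurable_continuous_onI)
  have aff: "(\<lambda>v. c + s *\<^sub>R v) \<in> borel_measurable borel" by measurable
  show "place s b y l \<in> borel_measurable borel" unfolding eq using \<sigma> aff by (rule measurable_comp)
  have "distr lborel borel (\<lambda>v::real \<times> real. (snd v, fst v)) = lborel"
    using lborel_pair.distr_pair_swap[where 'a = real and 'b = real]
    unfolding lborel_prod by (simp add: split_beta' cong: distr_cong)
  then have d\<sigma>: "distr lborel borel \<sigma> = lborel"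
    by (cases b) (simp_all add: \<sigma>_def[abs_def] prod.swap_def distr_id2)
  have "distr lborel borel (\<lambda>v. c + s *\<^sub>R v) = lborel"
    using lborel_affine[of s c] assms by (auto simp: density_1)
  then have "distr (distr lborel borel \<sigma>) borel (\<lambda>v. c + s *\<^sub>R v) = lborel"
    using d\<sigma> by simp
  then show "distr lborel borel (place s b y l) = lborel"
    unfolding eq using \<sigma> aff by (subst (asm) distr_distr) simp_all
qed

section \<open>Absence of arms forces an unbounded vacant component\<close>

text \<open>
  After scaling by \<open>l\<close>, the same finite set gives covers by balls of radius \<open>l\<close>, with a number of balls that does
  not depend on \<open>l\<close>.
\<close>

lemma finite_unit_cover:
  obtains P :: "'a::heine_borel set" where "finite P" "cball a r \<subseteq> (\<Union>p\<in>P. cball p 1)"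
proof -
  have "cball a r \<subseteq> (\<Union>p\<in>cball a r. ball p 1)" by force
  then obtain P where "P \<subseteq> cball a r" "finite P" "cball a r \<subseteq> (\<Union>p\<in>P. ball p 1)"
    by (rule compactE_image[OF compact_cball, rotated]) simp_all
  moreover have "(\<Union>p\<in>P. ball p 1) \<subseteq> (\<Union>p\<in>P. cball p 1)" by (intro UN_mono ball_subset_cball) auto
  ultimately show thesis using that by (meson order_trans)
qed

lemma real_between_powers:
  fixes t :: real
  assumes "5 ^ N < t"
  obtains n where "N \<le> n" "5 ^ n < t" "t \<le> 5 ^ Suc n"
proof -
  define m where "m = (LEAST m. t \<le> 5 ^ m)"
  obtain k where "t < 5 ^ k" using real_arch_pow[of 5 t] by auto
  then have "t \<le> 5 ^ k" by simp
  then have m: "t \<le> 5 ^ m" unfolding m_def by (rule LeastI)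
  have "N < m"
  proof (rule ccontr)
    assume "\<not> N < m"
    then have "(5::real) ^ m \<le> 5 ^ N" by (intro power_increasing) auto
    with m assms show False by linarith
  qed
  then obtain n where n: "m = Suc n" "N \<le> n" by (metis Suc_le_D Suc_le_eq Suc_le_mono)
  then have "\<not> t \<le> 5 ^ n" using not_less_Least[of n "\<lambda>m. t \<le> 5 ^ m"] by (simp add: m_def)
  then show thesis using that[of n] m n by simp
qed

definition mark_box :: "real \<times> real \<Rightarrow> real \<Rightarrow> real \<Rightarrow> real \<Rightarrow> ((real \<times> real) \<times> real) set" where
  "mark_box y \<rho> a b = ball y \<rho> \<times> {a<..b}"

text \<open>
  If all vacant components were bounded, an occupied path would join a point \<open>(t, 0)\<close>, with \<open>t\<close> arbitrarily large,
  to the negative half axis. It has length at least \<open>t\<close>, so with \<open>n\<close> the scale for which \<open>t\<close> is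
  between \<open>7 * 5 ^ n\<close> and \<open>35 * 5 ^ n\<close>, it is an arm at a grid point near \<open>(t, 0)\<close>. Only balls of
  radius at most \<open>5 ^ n\<close> matter for this arm: a larger ball that comes close has a radius comparable with its distance
  from the origin, and such balls do not occur beyond the first few scales.
\<close>

lemma unbounded_vacant_component_if_no_arms:
  assumes cover: "cball 0 35 \<subseteq> (\<Union>p\<in>P. cball p (1::real))"
    and small: "\<forall>\<^sub>F n in sequentially. \<eta> \<in> avoiding (mark_box 0 (47 * 5 ^ n) (5 ^ n) (5 ^ Suc n))"
    and arms: "\<forall>\<^sub>F n in sequentially. \<forall>p\<in>P.
      \<not> arm (\<eta> \<inter> reach (5 ^ n *\<^sub>R p) (5 ^ n) (5 ^ n)) (5 ^ n *\<^sub>R p) (5 ^ n)"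
  shows "\<exists>C\<in>components (vacant \<eta>). \<not> bounded C"
proof (rule ccontr)
  assume bdd: "\<not> (\<exists>C\<in>components (vacant \<eta>). \<not> bounded C)"
  obtain N where N: "\<And>n. n \<ge> N \<Longrightarrow> \<eta> \<in> avoiding (mark_box 0 (47 * 5 ^ n) (5 ^ n) (5 ^ Suc n))"
    "\<And>n p. n \<ge> N \<Longrightarrow> p \<in> P \<Longrightarrow> \<not> arm (\<eta> \<inter> reach (5 ^ n *\<^sub>R p) (5 ^ n) (5 ^ n)) (5 ^ n *\<^sub>R p) (5 ^ n)"
    using eventually_conj[OF small arms] unfolding eventually_sequentially by blast
  have "closed (vacant \<eta>)" unfolding vacant_def using open_occupied by (simp add: closed_Compl)
  then obtain g t s where g: "path g" "path_image g \<subseteq> - vacant \<eta>"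
    "pathstart g = (t, 0)" "pathfinish g = (- s, 0)" "7 * 5 ^ N < t" "0 \<le> s"
    using bounded_components_imp_complement_arc[of "vacant \<eta>" "7 * 5 ^ N"] bdd by auto
  have "5 ^ N < t / 7" using g(5) by simp
  then obtain n where "N \<le> n" "5 ^ n < t / 7" "t / 7 \<le> 5 ^ Suc n" by (rule real_between_powers)
  then have n: "N \<le> n" "7 * 5 ^ n \<le> t" "t \<le> 7 * 5 ^ Suc n" by simp_all
  let ?l = "5 ^ n :: real"
  have l: "0 < ?l" by simp
  have "0 \<le> t" using n(2) l by linarith
  have "(t / ?l, 0) \<in> cball (0 :: real \<times> real) 35"
    using n(3) l \<open>0 \<le> t\<close> by (simp add: pos_divide_le_eq)
  then obtain p where p: "p \<in> P" "dist p (t / ?l, 0) \<le> 1" using subsetD[OF cover] by (metis UN_E mem_cball)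
  let ?y = "?l *\<^sub>R p"
  have "?y - (t, 0) = ?l *\<^sub>R (p - (t / ?l, 0))" by (simp add: algebra_simps)
  then have "dist ?y (t, 0) = ?l * dist p (t / ?l, 0)" by (simp add: dist_norm)
  then have yt: "dist ?y (t, 0) \<le> ?l" using p(2) l by (simp add: mult_left_le)
  have "dist (t, 0::real) (- s, 0) = t + s" using \<open>0 \<le> t\<close> g(6) by (simp add: dist_Pair_Pair dist_real_def)
  then have "6 * ?l \<le> dist ?y (- s, 0)"
    using n(2) g(6) yt dist_triangle[of "(t, 0::real)" "(- s, 0)" ?y] by (simp add: dist_commute)
  then have arm: "arm \<eta> ?y ?l"
    unfolding arm_def using g yt by (intro exI[of _ g]) (auto simp: vacant_def)
  have "norm ?y \<le> 36 * ?l"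
  proof -
    have "norm (t, 0::real) = t" using \<open>0 \<le> t\<close> by simp
    moreover have "norm (?y - (t, 0)) \<le> ?l" using yt by (simp only: dist_norm)
    moreover have "t \<le> 35 * ?l" using n(3) by simp
    ultimately show ?thesis using norm_triangle_sub[of ?y "(t, 0)"] by linarith
  qed
  have "arm (\<eta> \<inter> reach ?y ?l ?l) ?y ?l"
  proof (rule arm_local[OF arm])
    fix x z assume xz: "(x, z) \<in> \<eta>" "0 \<le> z" "dist ?y x < 6 * ?l + z"
    show "z \<le> ?l"
    proof (rule ccontr)
      assume z: "\<not> z \<le> ?l"
      obtain m where m: "n \<le> m" "5 ^ m < z" "z \<le> 5 ^ Suc m" using z by (auto simp: not_le intro: real_between_powers[of n z])
      have "norm x \<le> norm ?y + dist ?y x" using norm_triangle_sub[of x ?y] by (simp add: dist_norm norm_minus_commute)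
      then have "norm x < 42 * ?l + z" using xz(3) \<open>norm ?y \<le> 36 * ?l\<close> by linarith
      moreover have "?l \<le> 5 ^ m" using m(1) by (intro power_increasing) auto
      moreover have "z \<le> 5 * 5 ^ m" using m(3) by simp
      \<comment> \<open>The centre is at distance below \<open>36 + 6\<close> times \<open>5 ^ n\<close> plus \<open>z\<close>, and \<open>z\<close> is at most \<open>5 * 5 ^ m\<close>.\<close>
      ultimately have "norm x < 47 * 5 ^ m" by linarith
      then have "(x, z) \<in> mark_box 0 (47 * 5 ^ m) (5 ^ m) (5 ^ Suc m)" using m by (simp add: mark_box_def)
      with xz(1) N(1)[of m] n(1) m(1) show False by (auto simp: avoiding_def)
    qed
  qed simp
  with N(2)[OF n(1) p(1)] show False by simp
qed

section \<open>A quadratic recursion with a summable error\<close>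

text \<open>
  Eventually \<open>K * (u n + b n)\<close> is below \<open>1 / 2\<close>, so the recursion gives \<open>2 * u (Suc n) \<le> u n + b n\<close>.
  Summing this inequality bounds the partial sums of \<open>u\<close>.
\<close>

lemma summable_of_quadratic_recursion:
  fixes u b :: "nat \<Rightarrow> real"
  assumes "\<And>n. 0 \<le> u n" "\<And>n. 0 \<le> b n" and "u \<longlonglongrightarrow> 0" "summable b"
    and rec: "\<And>n. u (Suc n) \<le> K * (u n + b n)\<^sup>2"
  shows "summable u"
proof -
  have "(\<lambda>n. K * (u n + b n)) \<longlonglongrightarrow> K * (0 + 0)"
    by (intro tendsto_intros assms summable_LIMSEQ_zero)
  then have "\<forall>\<^sub>F n in sequentially. K * (u n + b n) < 1 / 2"
    by (rule order_tendstoD) simp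
  then obtain N where N: "\<And>n. n \<ge> N \<Longrightarrow> K * (u n + b n) < 1 / 2"
    by (auto simp: eventually_sequentially)
  have half: "2 * u (Suc n) \<le> u n + b n" if "n \<ge> N" for n
  proof -
    have "K * (u n + b n)\<^sup>2 \<le> 1 / 2 * (u n + b n)"
      unfolding power2_eq_square mult.assoc[symmetric]
      using N[OF that] assms(1,2)[of n] by (intro mult_right_mono) auto
    with rec[of n] have "u (Suc n) \<le> 1 / 2 * (u n + b n)" by (rule order_trans)
    then show ?thesis by simp
  qed
  have sb: "summable (\<lambda>n. b (n + N))" using \<open>summable b\<close> by (rule summable_ignore_initial_segment)
  have tele: "(\<Sum>i<m. u (i + N)) + 2 * u (m + N) \<le> 2 * u N + (\<Sum>i<m. b (i + N))" for m
  proof (induction m)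
    case (Suc m)
    then show ?case using half[of "m + N"] by simp
  qed simp
  have "summable (\<lambda>i. u (i + N))"
  proof (rule summableI_nonneg_bounded[of _ "2 * u N + suminf (\<lambda>n. b (n + N))"])
    fix m
    have "(\<Sum>i<m. b (i + N)) \<le> suminf (\<lambda>n. b (n + N))"
      using sb assms(2) by (intro sum_le_suminf) auto
    then show "(\<Sum>i<m. u (i + N)) \<le> 2 * u N + suminf (\<lambda>n. b (n + N))"
      using tele[of m] assms(1)[of "m + N"] by linarith
  qed (simp add: assms(1))
  then show ?thesis by (simp add: summable_iff_shift)
qed

section \<open>The intensity measure of the Boolean model\<close>

locale boolean_law = avoidance_law Q "boolean_intensity lam \<mu>" for Q lam \<mu> +
  assumes radius: "radius_distribution \<mu>" and lam_pos: "0 < lam"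
    and second_moment: "integrable \<mu> (\<lambda>r. r\<^sup>2)"
begin

abbreviation "\<nu> \<equiv> boolean_intensity lam \<mu>"

lemma prob_space_radius: "prob_space \<mu>"
  and sets_radius: "sets \<mu> = sets (restrict_space borel {0..})"
  and space_radius: "space \<mu> = {0..}"
  using radius sets_eq_imp_space_eq[of \<mu> "restrict_space borel {0..}"]
  by (auto simp: radius_distribution_def space_restrict_space)

sublocale radius: prob_space \<mu> by (rule prob_space_radius)

sublocale marks: pair_sigma_finite lborel \<mu> ..

lemma sets_\<nu>: "sets \<nu> = sets (lborel \<Otimes>\<^sub>M \<mu>)"
  by (simp add: boolean_intensity_def)

lemma emeasure_\<nu>: "emeasure \<nu> A = ennreal lam * emeasure (lborel \<Otimes>\<^sub>M \<mu>) A"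
  by (simp add: boolean_intensity_def)

lemma borel_in_sets_\<nu>:
  assumes "D \<in> sets borel" "D \<subseteq> UNIV \<times> {0..}"
  shows "D \<in> sets \<nu>"
proof -
  have "(\<lambda>r. r) \<in> \<mu> \<rightarrow>\<^sub>M borel"
    unfolding measurable_cong_sets[OF sets_radius refl] by (rule measurable_restrict_space1) simp
  then have "(\<lambda>p. (fst p, snd p)) \<in> lborel \<Otimes>\<^sub>M \<mu> \<rightarrow>\<^sub>M borel"
    by (intro borel_measurable_Pair measurable_compose[OF measurable_snd])
       (auto intro: measurable_compose[OF measurable_fst])
  from measurable_sets[OF this assms(1)] show ?thesis
    using assms(2) by (simp add: sets_\<nu> space_pair_measure space_radius Int_absorb2)
qed

lemma sets_\<nu>_nonneg: "A \<in> sets \<nu> \<Longrightarrow> A \<subseteq> UNIV \<times> {0..}"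
  using sets.sets_into_space[of A "lborel \<Otimes>\<^sub>M \<mu>"] by (simp add: sets_\<nu> space_pair_measure space_radius)

lemma open_Int_in_sets_\<nu>:
  assumes "open B" "D \<in> sets \<nu>"
  shows "B \<inter> D \<in> sets \<nu>"
proof -
  have "B \<inter> UNIV \<times> {0..} \<in> sets \<nu>"
    using assms(1) by (intro borel_in_sets_\<nu> sets.Int borel_open borel_closed closed_Times) auto
  then have "B \<inter> UNIV \<times> {0..} \<inter> D \<in> sets \<nu>" using assms(2) by blast
  moreover have "B \<inter> UNIV \<times> {0..} \<inter> D = B \<inter> D" using sets_\<nu>_nonneg[OF assms(2)] by blast
  ultimately show ?thesis by simp
qed

lemma half_space_in_sets_\<nu>: "UNIV \<times> {0..} \<in> sets \<nu>"
  by (intro borel_in_sets_\<nu> borel_closed closed_Times) auto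

lemma reach_in_sets_\<nu>: "reach y l s \<in> sets \<nu>"
  by (intro borel_in_sets_\<nu> reach_borel) (auto simp: reach_def)

text \<open>
  Isometries of the plane act on the centres of the balls and keep the radii. By Fubini it suffices that they
  preserve the Lebesgue measure of each section at fixed radius.
\<close>

lemma vimage_isometry:
  assumes S: "S \<in> borel_measurable borel" "distr lborel borel S = lborel" and A: "A \<in> sets \<nu>"
  shows "map_prod S id -` A \<in> sets \<nu> \<and> emeasure \<nu> (map_prod S id -` A) = emeasure \<nu> A"
proof -
  have "(\<lambda>p. (S (fst p), snd p)) \<in> lborel \<Otimes>\<^sub>M \<mu> \<rightarrow>\<^sub>M lborel \<Otimes>\<^sub>M \<mu>"
    using S(1) by (intro measurable_Pair measurable_compose[OF measurable_fst] measurable_snd) simp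
  moreover have "map_prod S (id :: real \<Rightarrow> real) = (\<lambda>p. (S (fst p), snd p))" by (auto simp: fun_eq_iff)
  ultimately have "map_prod S id \<in> lborel \<Otimes>\<^sub>M \<mu> \<rightarrow>\<^sub>M lborel \<Otimes>\<^sub>M \<mu>" by (simp only:)
  from measurable_sets[OF this A[unfolded sets_\<nu>]]
  have "map_prod S id -` A \<inter> space (lborel \<Otimes>\<^sub>M \<mu>) \<in> sets \<nu>" unfolding sets_\<nu> .
  moreover have "map_prod S id -` A \<inter> space (lborel \<Otimes>\<^sub>M \<mu>) = map_prod S id -` A"
    using sets_\<nu>_nonneg[OF A] by (auto simp: space_pair_measure space_radius)
  ultimately have TA: "map_prod S id -` A \<in> sets \<nu>" by simp
  have sec: "emeasure lborel ((\<lambda>x. (x, r)) -` (map_prod S id -` A)) = emeasure lborel ((\<lambda>x. (x, r)) -` A)" for r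
  proof -
    have B: "(\<lambda>x. (x, r)) -` A \<in> sets borel" using sets_Pair2[of A lborel \<mu> r] A by (simp add: sets_\<nu>)
    have "emeasure lborel ((\<lambda>x. (x, r)) -` A) = emeasure (distr lborel borel S) ((\<lambda>x. (x, r)) -` A)"
      using S(2) by simp
    also have "\<dots> = emeasure lborel (S -` ((\<lambda>x. (x, r)) -` A))"
      using S(1) B by (simp add: emeasure_distr)
    also have "S -` ((\<lambda>x. (x, r)) -` A) = (\<lambda>x. (x, r)) -` (map_prod S id -` A)" by auto
    finally show ?thesis ..
  qed
  have "emeasure \<nu> (map_prod S id -` A) = emeasure \<nu> A"
    using TA A by (simp add: emeasure_\<nu> sets_\<nu> marks.emeasure_pair_measure_alt2 sec)
  with TA show ?thesis by simp
qed

lemma mark_box_in_sets_\<nu>: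
  assumes "0 \<le> a" "0 \<le> \<rho>"
  shows "mark_box y \<rho> a b \<in> sets \<nu>" "emeasure \<nu> (mark_box y \<rho> a b) < \<infinity>"
    "measure \<nu> (mark_box y \<rho> a b) = lam * (pi * \<rho>\<^sup>2) * measure \<mu> {a<..b}"
proof -
  have ab: "{a<..b} \<in> sets \<mu>"
    unfolding sets_radius using assms by (auto simp: sets_restrict_space_iff)
  then show "mark_box y \<rho> a b \<in> sets \<nu>" by (simp add: mark_box_def sets_\<nu>)
  have "emeasure \<nu> (mark_box y \<rho> a b) = ennreal lam * (emeasure lborel (ball y \<rho>) * emeasure \<mu> {a<..b})"
    using ab by (simp add: mark_box_def emeasure_\<nu> radius.emeasure_pair_measure_Times)
  also have "\<dots> = ennreal (lam * (pi * \<rho>\<^sup>2) * measure \<mu> {a<..b})"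
    using assms lam_pos
    by (simp add: emeasure_ball unit_ball_vol_2 radius.emeasure_eq_measure ennreal_mult''[symmetric] ennreal_mult'[symmetric] mult.assoc power2_eq_square)
  finally have *: "emeasure \<nu> (mark_box y \<rho> a b) = ennreal (lam * (pi * \<rho>\<^sup>2) * measure \<mu> {a<..b})" .
  then show "emeasure \<nu> (mark_box y \<rho> a b) < \<infinity>" by simp
  show "measure \<nu> (mark_box y \<rho> a b) = lam * (pi * \<rho>\<^sup>2) * measure \<mu> {a<..b}"
    using * lam_pos by (simp add: measure_def)
qed

section \<open>Events of the Boolean model\<close>

lemma covering_event:
  assumes "\<And>K. K \<in> \<K> \<Longrightarrow> compact K" "D \<in> sets \<nu>"
  shows "{\<eta>. \<exists>K\<in>\<K>. K \<subseteq> occupied (\<eta> \<inter> D)} \<in> sigma_sets UNIV (avoiding ` {A \<in> sets \<nu>. A \<subseteq> D})"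
  using assms open_Int_in_sets_\<nu> by (intro covering_in_sigma_sets) auto

lemma local_sigma_sets_events: "sigma_sets UNIV (avoiding ` {A \<in> sets \<nu>. A \<subseteq> D}) \<subseteq> events"
  using sets.sigma_sets_subset[of "avoiding ` {A \<in> sets \<nu>. A \<subseteq> D}" Q] by auto

lemma arm_local_event:
  assumes "D \<in> sets \<nu>"
  shows "{\<eta>. arm (\<eta> \<inter> D) y l} \<in> sigma_sets UNIV (avoiding ` {A \<in> sets \<nu>. A \<subseteq> D})"
proof -
  let ?K = "{path_image g |g. path g \<and> dist y (pathstart g) \<le> l \<and> 6 * l \<le> dist y (pathfinish g)}"
  have "{\<eta>. \<exists>K\<in>?K. K \<subseteq> occupied (\<eta> \<inter> D)} \<in> sigma_sets UNIV (avoiding ` {A \<in> sets \<nu>. A \<subseteq> D})"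
    using assms by (intro covering_event) (auto simp: compact_path_image)
  moreover have "arm (\<eta> \<inter> D) y l \<longleftrightarrow> (\<exists>K\<in>?K. K \<subseteq> occupied (\<eta> \<inter> D))" for \<eta>
    unfolding arm_def by blast
  ultimately show ?thesis by simp
qed

lemma arm_in_events: "{\<eta>. arm (\<eta> \<inter> reach y l s) y' l'} \<in> events" "{\<eta>. arm \<eta> y l} \<in> events"
proof -
  show "{\<eta>. arm (\<eta> \<inter> reach y l s) y' l'} \<in> events"
    using arm_local_event[OF reach_in_sets_\<nu>] local_sigma_sets_events by blast
  have "{\<eta>. arm (\<eta> \<inter> UNIV \<times> {0..}) y l} \<in> events"
    using arm_local_event[OF half_space_in_sets_\<nu>] local_sigma_sets_events by blast
  then show "{\<eta>. arm \<eta> y l} \<in> events" unfolding arm_def occupied_nonneg_radii .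
qed

lemma crossed_event: "{\<eta>. crossed \<eta> l r} \<in> events"
proof -
  let ?K = "{path_image g |g. path g \<and> path_image g \<subseteq> {0..l} \<times> {0..r} \<and>
    pathstart g \<in> {0} \<times> {0..r} \<and> pathfinish g \<in> {l} \<times> {0..r}}"
  have "{\<eta>. \<exists>K\<in>?K. K \<subseteq> occupied (\<eta> \<inter> UNIV \<times> {0..})} \<in> sigma_sets UNIV (avoiding ` {A \<in> sets \<nu>. A \<subseteq> UNIV \<times> {0..}})"
    using half_space_in_sets_\<nu> by (intro covering_event) (auto simp: compact_path_image)
  then have "{\<eta>. \<exists>K\<in>?K. K \<subseteq> occupied \<eta>} \<in> events"
    unfolding occupied_nonneg_radii using local_sigma_sets_events by (rule subsetD[rotated])
  moreover have "crossed \<eta> l r \<longleftrightarrow> (\<exists>K\<in>?K. K \<subseteq> occupied \<eta>)" for \<eta>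
    unfolding crossed_def by (simp only: le_inf_iff Bex_def mem_Collect_eq) metis
  ultimately show ?thesis by (simp only:)
qed

text \<open>
  Each of the four rectangles is the isometric image of one and the same rectangle, and the law of the process is
  invariant under isometries.
\<close>

lemma prob_arm_le_crossed:
  assumes "0 < l"
  shows "prob {\<eta>. arm \<eta> y l} \<le> 4 * prob {\<eta>. crossed \<eta> (2 * l) (6 * l)}"
proof -
  let ?C = "{\<eta>. crossed \<eta> (2 * l) (6 * l)}"
  let ?E = "\<lambda>(s, b). image (map_prod (place s b y l) id) -` ?C"
  let ?I = "{1, - 1 :: real} \<times> (UNIV :: bool set)"
  have E: "?E i \<in> events \<and> prob (?E i) = prob ?C" if "i \<in> ?I" for i
  proof -
    obtain s b where i: "i = (s, b)" "\<bar>s\<bar> = 1" using \<open>i \<in> ?I\<close> by auto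
    let ?T = "image (map_prod (place s b y l) id)"
    have meas: "?T \<in> Q \<rightarrow>\<^sub>M Q" and eq: "distr Q Q ?T = Q"
      by (rule distr_image_eq[OF vimage_isometry[OF distr_lborel_place[OF i(2)]]]; assumption)+
    have "prob ?C = measure (distr Q Q ?T) ?C" by (simp only: eq)
    also have "\<dots> = prob (?T -` ?C)" using measure_distr[OF meas crossed_event] by simp
    finally show ?thesis using measurable_sets[OF meas crossed_event] i(1) by simp
  qed
  have fin: "finite ?I" by simp
  have "{\<eta>. arm \<eta> y l} \<subseteq> (\<Union>i\<in>?I. ?E i)"
  proof
    fix \<eta> assume "\<eta> \<in> {\<eta>. arm \<eta> y l}"
    then obtain s b where "s \<in> {1, - 1}" "crossed (map_prod (place s b y l) id ` \<eta>) (2 * l) (6 * l)"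
      using arm_imp_crossed[of \<eta> y l] assms by auto
    then show "\<eta> \<in> (\<Union>i\<in>?I. ?E i)" by (intro UN_I[of "(s, b)"]) auto
  qed
  then have "prob {\<eta>. arm \<eta> y l} \<le> prob (\<Union>i\<in>?I. ?E i)"
    using E by (intro finite_measure_mono sets.finite_UN fin) auto
  also have "\<dots> \<le> (\<Sum>i\<in>?I. prob (?E i))"
    using E by (intro finite_measure_subadditive_finite fin) auto
  also have "\<dots> = (\<Sum>i\<in>?I. prob ?C)" using E by (intro sum.cong refl) blast
  also have "\<dots> = 4 * prob ?C" by (simp add: card_cartesian_product)
  finally show ?thesis .
qed

section \<open>Renormalization of the arm probabilities\<close>

text \<open>
  Up to a constant, the expected number of balls with radius between \<open>5 ^ n\<close> and \<open>5 ^ Suc n\<close> and centre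
  within distance of order \<open>5 ^ n\<close> of a given point.
\<close>

definition radius_mass :: "nat \<Rightarrow> real" where
  "radius_mass n = (5 ^ n)\<^sup>2 * measure \<mu> {5 ^ n<..5 ^ Suc n}"

lemma radius_mass_nonneg: "0 \<le> radius_mass n"
  by (simp add: radius_mass_def)

text \<open>
  For a radius in the \<open>n\<close>-th interval the weight \<open>(5 ^ n)\<^sup>2\<close> is below its square, and the intervals are
  disjoint. So the series is bounded by the second moment.
\<close>

lemma summable_radius_mass: "summable radius_mass"
proof (rule summableI_nonneg_bounded[of _ "\<integral>r. r\<^sup>2 \<partial>\<mu>"])
  fix N
  let ?f = "\<lambda>n r. (5 ^ n)\<^sup>2 * indicator {5 ^ n<..5 ^ Suc n} r :: real"
  have meas: "{5 ^ n<..5 ^ Suc n} \<in> sets \<mu>" for n :: nat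
    unfolding sets_radius by (auto simp: sets_restrict_space_iff intro: order_less_imp_le order_less_trans[of 0 "5 ^ n"])
  have int: "integrable \<mu> (?f n)" for n using meas by (simp add: integrable_real_indicator radius.emeasure_eq_measure)
  have "radius_mass n = (\<integral>r. ?f n r \<partial>\<mu>)" for n
    using meas[of n] by (simp add: radius_mass_def sets.Int_space_eq2)
  then have "sum radius_mass {..<N} = (\<Sum>n<N. \<integral>r. ?f n r \<partial>\<mu>)" by (intro sum.cong refl)
  also have "\<dots> = (\<integral>r. (\<Sum>n<N. ?f n r) \<partial>\<mu>)" by (rule Bochner_Integration.integral_sum[symmetric]) (rule int)
  also have "\<dots> \<le> (\<integral>r. r\<^sup>2 \<partial>\<mu>)"
  proof (intro integral_mono second_moment)
    show "integrable \<mu> (\<lambda>r. \<Sum>n<N. ?f n r)" by (rule Bochner_Integration.integrable_sum) (rule int)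
    fix r :: real
    \<comment> \<open>The stronger bound, which vanishes beyond \<open>5 ^ N\<close>, expresses the disjointness and makes the induction work.\<close>
    have "(\<Sum>n<N. ?f n r) \<le> (if r \<le> 5 ^ N then r\<^sup>2 else 0)" for N
    proof (induction N)
      case (Suc N)
      have split: "(\<Sum>n<Suc N. ?f n r) = (\<Sum>n<N. ?f n r) + ?f N r" by (rule sum.lessThan_Suc)
      have up: "(5::real) ^ N \<le> 5 ^ Suc N" by simp
      consider "r \<le> 5 ^ N" | "5 ^ N < r" "r \<le> 5 ^ Suc N" | "5 ^ Suc N < r" by linarith
      then show ?case
      proof cases
        case 1
        then have "?f N r = 0" by simp
        moreover have "(\<Sum>n<N. ?f n r) \<le> r\<^sup>2" using Suc 1 by (simp only: if_True)
        ultimately have "(\<Sum>n<N. ?f n r) + ?f N r \<le> r\<^sup>2" by linarith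
        then show ?thesis using order_trans[OF 1 up] unfolding split by (simp only: if_True)
      next
        case 2
        then have "?f N r = (5 ^ N)\<^sup>2" by simp
        moreover have "(5 ^ N)\<^sup>2 \<le> r\<^sup>2" using 2 by (intro power_mono) auto
        moreover have "(\<Sum>n<N. ?f n r) \<le> 0" using Suc 2 by (simp only: not_le[symmetric] if_False)
        ultimately have "(\<Sum>n<N. ?f n r) + ?f N r \<le> r\<^sup>2" by linarith
        then show ?thesis using 2(2) unfolding split by (simp only: if_True)
      next
        case 3
        then have "?f N r = 0" by simp
        moreover have "(\<Sum>n<N. ?f n r) \<le> 0"
          using Suc order_le_less_trans[OF up 3] by (simp only: not_le[symmetric] if_False)
        ultimately have "(\<Sum>n<N. ?f n r) + ?f N r \<le> 0" by linarith
        then show ?thesis using 3 unfolding split by (simp only: not_le[symmetric] if_False)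
      qed
    qed simp
    then show "(\<Sum>n<N. ?f n r) \<le> r\<^sup>2" by (rule order_trans) simp
  qed
  finally show "sum radius_mass {..<N} \<le> (\<integral>r. r\<^sup>2 \<partial>\<mu>)" .
qed (rule radius_mass_nonneg)

definition arm_prob :: "nat \<Rightarrow> real \<Rightarrow> real \<times> real \<Rightarrow> real" where
  "arm_prob n s y = prob {\<eta>. arm (\<eta> \<inter> reach y (5 ^ n) s) y (5 ^ n)}"

text \<open>
  The supremum over the position makes the recursion over scales close up for this one sequence.
\<close>

definition max_arm_prob :: "nat \<Rightarrow> real" where
  "max_arm_prob n = (SUP y. arm_prob n (5 ^ n) y)"

lemma arm_prob_le_max: "arm_prob n (5 ^ n) y \<le> max_arm_prob n"
  unfolding max_arm_prob_def
  by (rule cSUP_upper) (auto simp: arm_prob_def intro!: bdd_aboveI[of _ 1])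

lemma max_arm_prob_nonneg: "0 \<le> max_arm_prob n"
  using arm_prob_le_max[of n 0] by (rule order_trans[rotated]) (simp add: arm_prob_def)

lemma max_arm_prob_tendsto_0:
  assumes "((\<lambda>l. prob {\<eta>. crossed \<eta> l (3 * l)}) \<longlongrightarrow> 0) at_top"
  shows "max_arm_prob \<longlonglongrightarrow> 0"
proof -
  have "arm_prob n (5 ^ n) y \<le> 4 * prob {\<eta>. crossed \<eta> (2 * 5 ^ n) (3 * (2 * 5 ^ n))}" for n y
  proof -
    have "arm_prob n (5 ^ n) y \<le> prob {\<eta>. arm \<eta> y (5 ^ n)}"
      unfolding arm_prob_def using arm_mono[of "_ \<inter> reach y (5 ^ n) (5 ^ n)"]
      by (intro finite_measure_mono arm_in_events) blast
    also have "\<dots> \<le> 4 * prob {\<eta>. crossed \<eta> (2 * 5 ^ n) (6 * 5 ^ n)}"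
      by (rule prob_arm_le_crossed) simp
    finally show ?thesis by simp
  qed
  then have le: "max_arm_prob n \<le> 4 * prob {\<eta>. crossed \<eta> (2 * 5 ^ n) (3 * (2 * 5 ^ n))}" for n
    unfolding max_arm_prob_def by (intro cSUP_least) auto
  have "filterlim (\<lambda>n::nat. 2 * 5 ^ n :: real) at_top sequentially"
  proof (rule filterlim_at_top_mono[OF filterlim_real_sequentially always_eventually], rule allI)
    fix n
    have "real n \<le> 2 ^ n" by (rule of_nat_less_two_power[THEN less_imp_le])
    also have "\<dots> \<le> 5 ^ n" by (rule power_mono) auto
    finally show "real n \<le> 2 * 5 ^ n" using zero_le_power[of "5::real" n] by linarith
  qed
  from filterlim_compose[OF assms this]
  have "(\<lambda>n. 4 * prob {\<eta>. crossed \<eta> (2 * 5 ^ n) (3 * (2 * 5 ^ n))}) \<longlonglongrightarrow> 4 * 0"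
    by (intro tendsto_mult tendsto_const)
  then have lim: "(\<lambda>n. 4 * prob {\<eta>. crossed \<eta> (2 * 5 ^ n) (3 * (2 * 5 ^ n))}) \<longlonglongrightarrow> 0" by simp
  show ?thesis
    by (rule tendsto_sandwich[OF _ _ tendsto_const lim]) (use max_arm_prob_nonneg le in auto)
qed

text \<open>
  Unless there is a ball with radius between \<open>5 ^ n\<close> and \<open>5 ^ Suc n\<close> within reach, the arm uses radii up to \<open>5 ^ n\<close>
  only. Such a ball has its centre within \<open>6 * 5 ^ n + 5 ^ Suc n\<close> of \<open>y\<close>, that is \<open>11 * 5 ^ n\<close>, whence \<open>121 = 11\<^sup>2\<close>.
\<close>

lemma arm_prob_next_radius_le:
  "arm_prob n (5 ^ Suc n) y \<le> max_arm_prob n + 121 * pi * lam * radius_mass n"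
proof -
  let ?l = "5 ^ n :: real"
  let ?S = "mark_box y (11 * ?l) ?l (5 ^ Suc n)"
  have S: "?S \<in> sets \<nu>" "emeasure \<nu> ?S < \<infinity>" "measure \<nu> ?S = lam * (pi * (11 * ?l)\<^sup>2) * measure \<mu> {?l<..5 ^ Suc n}"
    using mark_box_in_sets_\<nu>[of ?l "11 * ?l" y "5 ^ Suc n"] by auto
  have "{\<eta>. arm (\<eta> \<inter> reach y ?l (5 ^ Suc n)) y ?l} \<subseteq> {\<eta>. arm (\<eta> \<inter> reach y ?l ?l) y ?l} \<union> - avoiding ?S"
  proof (intro subsetI)
    fix \<eta> assume \<eta>: "\<eta> \<in> {\<eta>. arm (\<eta> \<inter> reach y ?l (5 ^ Suc n)) y ?l}"
    show "\<eta> \<in> {\<eta>. arm (\<eta> \<inter> reach y ?l ?l) y ?l} \<union> - avoiding ?S"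
    proof (cases "\<eta> \<in> avoiding ?S")
      case True
      have small: "z \<le> ?l" if "(x, z) \<in> \<eta> \<inter> reach y ?l (5 ^ Suc n)" for x z
      proof (rule ccontr)
        assume "\<not> z \<le> ?l"
        with that have "(x, z) \<in> \<eta> \<inter> ?S" by (auto simp: reach_def mark_box_def)
        with True show False unfolding avoiding_def by blast
      qed
      have "arm (\<eta> \<inter> reach y ?l (5 ^ Suc n) \<inter> reach y ?l ?l) y ?l"
      proof (rule arm_local)
        show "arm (\<eta> \<inter> reach y ?l (5 ^ Suc n)) y ?l" using \<eta> by blast
        show "z \<le> ?l" if "(x, z) \<in> \<eta> \<inter> reach y ?l (5 ^ Suc n)" for x z
          by (rule small[OF that])
      qed simp
      then have "arm (\<eta> \<inter> reach y ?l ?l) y ?l" by (rule arm_mono) blast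
      then show ?thesis by blast
    qed blast
  qed
  then have "arm_prob n (5 ^ Suc n) y \<le> prob ({\<eta>. arm (\<eta> \<inter> reach y ?l ?l) y ?l} \<union> - avoiding ?S)"
    unfolding arm_prob_def using S(1) arm_in_events sets.compl_sets[of "avoiding ?S" Q]
    by (intro finite_measure_mono sets.Un) (auto simp: Compl_eq_Diff_UNIV[symmetric])
  also have "\<dots> \<le> arm_prob n ?l y + prob (- avoiding ?S)"
    unfolding arm_prob_def using S(1) arm_in_events sets.compl_sets[of "avoiding ?S" Q]
    by (intro measure_Un_le) (auto simp: Compl_eq_Diff_UNIV[symmetric])
  also have "\<dots> \<le> max_arm_prob n + measure \<nu> ?S"
    by (intro add_mono arm_prob_le_max prob_not_avoiding_le S)
  also have "measure \<nu> ?S = 121 * pi * lam * radius_mass n"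
    unfolding S(3) radius_mass_def by (simp add: power2_eq_square)
  finally show ?thesis .
qed

text \<open>
  Sum over the pairs of positions of the two small arms found by \<open>arm_splits\<close>. For each pair these arms
  depend on disjoint parts of the process, so the probabilities multiply.
\<close>

lemma max_arm_prob_Suc_le:
  fixes P :: "(real \<times> real) set"
  assumes P: "finite P" "cball 0 35 \<subseteq> (\<Union>p\<in>P. cball p 1)"
  shows "max_arm_prob (Suc n) \<le> (real (card P))\<^sup>2 * (max_arm_prob n + 121 * pi * lam * radius_mass n)\<^sup>2"
  unfolding max_arm_prob_def[of "Suc n"]
proof (rule cSUP_least)
  fix y
  let ?l = "5 ^ n :: real"
  let ?v = "max_arm_prob n + 121 * pi * lam * radius_mass n"
  let ?R = "\<lambda>p. reach (y + ?l *\<^sub>R p) ?l (5 * ?l)"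
  let ?X = "\<lambda>p. {\<eta>. arm (\<eta> \<inter> ?R p) (y + ?l *\<^sub>R p) ?l}"
  let ?I = "{(p, q) \<in> P \<times> P. 23 * ?l \<le> dist (y + ?l *\<^sub>R p) (y + ?l *\<^sub>R q)}"
  have fin: "finite ?I" by (rule finite_subset[of _ "P \<times> P"]) (use P(1) in auto)
  have X: "?X p \<in> events" for p by (rule arm_in_events)
  have v: "0 \<le> ?v" using max_arm_prob_nonneg lam_pos radius_mass_nonneg by simp
  have indep: "prob (?X p \<inter> ?X q) \<le> ?v\<^sup>2" if "(p, q) \<in> ?I" for p q
  proof -
    have "?R p \<inter> ?R q = {}"
    proof (rule ccontr)
      assume "?R p \<inter> ?R q \<noteq> {}"
      then obtain x z where "(x, z) \<in> ?R p" "(x, z) \<in> ?R q" by (metis disjoint_iff surj_pair)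
      then have "dist (y + ?l *\<^sub>R p) x < 11 * ?l" "dist (y + ?l *\<^sub>R q) x < 11 * ?l"
        by (simp_all add: reach_def)
      then have "dist (y + ?l *\<^sub>R p) (y + ?l *\<^sub>R q) < 22 * ?l"
        using dist_triangle2[of "y + ?l *\<^sub>R p" "y + ?l *\<^sub>R q" x] by linarith
      moreover have "23 * ?l \<le> dist (y + ?l *\<^sub>R p) (y + ?l *\<^sub>R q)" using that by simp
      moreover have "0 < ?l" by simp
      ultimately show False by linarith
    qed
    then have "prob (?X p \<inter> ?X q) = prob (?X p) * prob (?X q)"
      by (intro indep_disjoint_regions[of "?R p" "?R q"] reach_in_sets_\<nu> arm_local_event)
    also have "\<dots> \<le> ?v * ?v"
      using arm_prob_next_radius_le[of n "y + ?l *\<^sub>R p"] arm_prob_next_radius_le[of n "y + ?l *\<^sub>R q"]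
      unfolding arm_prob_def power_Suc by (intro mult_mono v measure_nonneg)
    finally show ?thesis by (simp add: power2_eq_square)
  qed
  have "{\<eta>. arm (\<eta> \<inter> reach y (5 ^ Suc n) (5 ^ Suc n)) y (5 ^ Suc n)} \<subseteq> (\<Union>(p, q)\<in>?I. ?X p \<inter> ?X q)"
  proof
    fix \<eta> assume "\<eta> \<in> {\<eta>. arm (\<eta> \<inter> reach y (5 ^ Suc n) (5 ^ Suc n)) y (5 ^ Suc n)}"
    then have "arm (\<eta> \<inter> reach y (5 ^ Suc n) (5 * ?l)) y (5 * ?l)" by simp
    then obtain p q where pq: "p \<in> P" "q \<in> P" "23 * ?l \<le> dist (y + ?l *\<^sub>R p) (y + ?l *\<^sub>R q)"
      and arms: "arm (\<eta> \<inter> reach y (5 ^ Suc n) (5 * ?l)) (y + ?l *\<^sub>R p) ?l"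
        "arm (\<eta> \<inter> reach y (5 ^ Suc n) (5 * ?l)) (y + ?l *\<^sub>R q) ?l"
      using arm_splits[of "\<eta> \<inter> reach y (5 ^ Suc n) (5 * ?l)" y ?l P] P(2) by (metis zero_less_power zero_less_numeral)
    have loc: "arm (\<eta> \<inter> reach y' ?l (5 * ?l)) y' ?l" if "arm (\<eta> \<inter> reach y (5 ^ Suc n) (5 * ?l)) y' ?l" for y'
    proof -
      have "arm (\<eta> \<inter> reach y (5 ^ Suc n) (5 * ?l) \<inter> reach y' ?l (5 * ?l)) y' ?l"
        using that by (rule arm_local) (auto simp: reach_def)
      then show ?thesis by (rule arm_mono) blast
    qed
    have "(p, q) \<in> ?I" using pq by simp
    moreover have "\<eta> \<in> ?X p \<inter> ?X q" using arms[THEN loc] by simp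
    ultimately show "\<eta> \<in> (\<Union>(p, q)\<in>?I. ?X p \<inter> ?X q)" by blast
  qed
  then have "arm_prob (Suc n) (5 ^ Suc n) y \<le> prob (\<Union>(p, q)\<in>?I. ?X p \<inter> ?X q)"
    unfolding arm_prob_def using X by (intro finite_measure_mono sets.finite_UN fin) auto
  also have "\<dots> \<le> (\<Sum>i\<in>?I. prob (case i of (p, q) \<Rightarrow> ?X p \<inter> ?X q))"
    using X by (intro finite_measure_subadditive_finite fin) auto
  also have "\<dots> \<le> (\<Sum>i\<in>?I. ?v\<^sup>2)"
  proof (rule sum_mono)
    fix i assume i: "i \<in> ?I"
    show "prob (case i of (p, q) \<Rightarrow> ?X p \<inter> ?X q) \<le> ?v\<^sup>2"
      using indep[of "fst i" "snd i"] i by (simp only: prod.collapse split_beta)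
  qed
  also have "\<dots> = real (card ?I) * ?v\<^sup>2" by simp
  also have "\<dots> \<le> real (card (P \<times> P)) * ?v\<^sup>2"
    using P(1) by (intro mult_right_mono of_nat_mono card_mono) auto
  also have "\<dots> = (real (card P))\<^sup>2 * ?v\<^sup>2" by (simp add: card_cartesian_product power2_eq_square)
  finally show "arm_prob (Suc n) (5 ^ Suc n) y \<le> (real (card P))\<^sup>2 * ?v\<^sup>2" .
qed simp

lemma summable_max_arm_prob:
  assumes "((\<lambda>l. prob {\<eta>. crossed \<eta> l (3 * l)}) \<longlongrightarrow> 0) at_top"
  shows "summable max_arm_prob"
proof -
  obtain P :: "(real \<times> real) set" where P: "finite P" "cball 0 35 \<subseteq> (\<Union>p\<in>P. cball p 1)"
    using finite_unit_cover by blast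
  show ?thesis
  proof (rule summable_of_quadratic_recursion[OF max_arm_prob_nonneg _ max_arm_prob_tendsto_0[OF assms] _ max_arm_prob_Suc_le[OF P]])
    show "0 \<le> 121 * pi * lam * radius_mass n" for n using lam_pos radius_mass_nonneg by simp
    show "summable (\<lambda>n. 121 * pi * lam * radius_mass n)" by (intro summable_mult summable_radius_mass)
  qed
qed

section \<open>Almost sure existence of an unbounded vacant component\<close>

text \<open>
  The expected number of balls in the \<open>n\<close>-th box is a multiple of \<open>radius_mass n\<close>, hence summable.
\<close>

lemma AE_eventually_no_large_balls:
  "AE \<eta> in Q. \<forall>\<^sub>F n in sequentially. \<eta> \<in> avoiding (mark_box 0 (47 * 5 ^ n) (5 ^ n) (5 ^ Suc n))"
proof -
  let ?S = "\<lambda>n. mark_box 0 (47 * 5 ^ n) (5 ^ n) (5 ^ Suc n)"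
  have S: "?S n \<in> sets \<nu>" "emeasure \<nu> (?S n) < \<infinity>"
    and mS: "measure \<nu> (?S n) = lam * (pi * (47 * 5 ^ n)\<^sup>2) * measure \<mu> {5 ^ n<..5 ^ Suc n}" for n
    by (rule mark_box_in_sets_\<nu>; simp)+
  have "measure \<nu> (?S n) = 2209 * pi * lam * radius_mass n" for n
    unfolding mS radius_mass_def by (simp add: power2_eq_square)
  then have sum: "summable (\<lambda>n. measure \<nu> (?S n))" by (simp add: summable_mult summable_radius_mass)
  have ev: "- avoiding (?S n) \<in> events" for n
    using sets.compl_sets[OF avoiding_event[OF S(1)]] by (simp add: Compl_eq_Diff_UNIV[symmetric])
  have "summable (\<lambda>n. prob (- avoiding (?S n)))"
    by (rule summable_comparison_test_ev[OF _ sum]) (use prob_not_avoiding_le S in auto)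
  with ev have "AE \<eta> in Q. \<forall>\<^sub>F n in sequentially. \<eta> \<in> space Q - - avoiding (?S n)"
    by (intro borel_cantelli_AE1) (auto simp: emeasure_eq_measure)
  then show ?thesis by simp
qed

lemma AE_eventually_no_arms:
  assumes P: "finite P"
    and "((\<lambda>l. prob {\<eta>. crossed \<eta> l (3 * l)}) \<longlongrightarrow> 0) at_top"
  shows "AE \<eta> in Q. \<forall>\<^sub>F n in sequentially. \<forall>p\<in>P.
    \<not> arm (\<eta> \<inter> reach (5 ^ n *\<^sub>R p) (5 ^ n) (5 ^ n)) (5 ^ n *\<^sub>R p) (5 ^ n)"
proof -
  let ?A = "\<lambda>n p. {\<eta>. arm (\<eta> \<inter> reach (5 ^ n *\<^sub>R p) (5 ^ n) (5 ^ n)) (5 ^ n *\<^sub>R p) (5 ^ n)}"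
  have A: "?A n p \<in> events" for n p by (rule arm_in_events)
  have le: "prob (\<Union>p\<in>P. ?A n p) \<le> real (card P) * max_arm_prob n" for n
  proof -
    have "prob (\<Union>p\<in>P. ?A n p) \<le> (\<Sum>p\<in>P. prob (?A n p))"
      using A P by (intro finite_measure_subadditive_finite) auto
    also have "\<dots> \<le> (\<Sum>p\<in>P. max_arm_prob n)"
      by (intro sum_mono arm_prob_le_max[unfolded arm_prob_def])
    finally show ?thesis by simp
  qed
  have "summable (\<lambda>n. real (card P) * max_arm_prob n)"
    by (intro summable_mult summable_max_arm_prob assms(2))
  then have "summable (\<lambda>n. prob (\<Union>p\<in>P. ?A n p))"
    by (rule summable_comparison_test_ev[rotated]) (use le in auto)
  moreover have "(\<Union>p\<in>P. ?A n p) \<in> events" for n using A P by (intro sets.finite_UN) auto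
  ultimately have "AE \<eta> in Q. \<forall>\<^sub>F n in sequentially. \<eta> \<in> space Q - (\<Union>p\<in>P. ?A n p)"
    by (intro borel_cantelli_AE1) (auto simp: emeasure_eq_measure)
  then show ?thesis by simp
qed

theorem AE_unbounded_vacant_component:
  assumes "((\<lambda>l. prob {\<eta>. crossed \<eta> l (3 * l)}) \<longlongrightarrow> 0) at_top"
  shows "AE \<eta> in Q. \<exists>C\<in>components (vacant \<eta>). \<not> bounded C"
proof -
  obtain P :: "(real \<times> real) set" where P: "finite P" "cball 0 35 \<subseteq> (\<Union>p\<in>P. cball p 1)"
    using finite_unit_cover by blast
  show ?thesis
    using AE_eventually_no_large_balls AE_eventually_no_arms[OF P(1) assms]
  proof eventually_elim
    case (elim \<eta>)
    then show ?case by (rule unbounded_vacant_component_if_no_arms[OF P(2)])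
  qed
qed

end

theorem theorem3:
  fixes \<mu> :: "real measure" and lam :: real
    and M :: "'w measure" and \<omega> :: "'w \<Rightarrow> ((real \<times> real) \<times> real) set"
  assumes "radius_distribution \<mu>"
    and "integrable \<mu> (\<lambda>r. r\<^sup>2)"
    and "lam > 0"
    and "poisson_point_process M (boolean_intensity lam \<mu>) \<omega>"
    and "((\<lambda>l. measure M (cross_event M \<omega> l (3 * l))) \<longlongrightarrow> 0) at_top"
  shows "AE w in M. \<exists>C \<in> components (vacant (\<omega> w)). \<not> bounded C"
proof -
  let ?N = "config_algebra (boolean_intensity lam \<mu>)"
  have meas: "\<omega> \<in> M \<rightarrow>\<^sub>M ?N" and law: "avoidance_law (distr M ?N \<omega>) (boolean_intensity lam \<mu>)"
    using avoidance_law_distr_poisson[OF assms(4)] by auto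
  interpret boolean_law "distr M ?N \<omega>" lam \<mu>
    using law assms(1-3) by (intro boolean_law.intro boolean_law_axioms.intro)
  have "prob {\<eta>. crossed \<eta> l r} = measure M (cross_event M \<omega> l r)" for l r
  proof -
    have "{\<eta>. crossed \<eta> l r} \<in> sets ?N" using crossed_event by simp
    then have "prob {\<eta>. crossed \<eta> l r} = measure M (\<omega> -` {\<eta>. crossed \<eta> l r} \<inter> space M)"
      by (rule measure_distr[OF meas])
    also have "\<omega> -` {\<eta>. crossed \<eta> l r} \<inter> space M = cross_event M \<omega> l r"
      by (auto simp: cross_event_def)
    finally show ?thesis .
  qed
  then have "AE \<eta> in distr M ?N \<omega>. \<exists>C\<in>components (vacant \<eta>). \<not> bounded C"
    using assms(5) by (intro AE_unbounded_vacant_component) simp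
  then show ?thesis by (rule AE_distrD[OF meas])
qed

end
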